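(* The sub-$C^\ast$-algebra $\mathcal{C}=C^\ast\{A_v,B_{\tilde v}\mid v\in V,\ \tilde v\in\tilde V\}$ of $\mathcal{A}$ has the unique extension property: every pure state on $\mathcal{C}$ extends uniquely to $\mathcal{A}$ as a pure state.
   Context: Let $\mathcal{L}$ be the infinite planar square lattice (vertex set $V=\mathbb{Z}^2$, nearest-neighbour edges), with set of unoriented edges $E$. Let $\tilde V$ be the set of faces of $\mathcal{L}$; for $\tilde v\in\tilde V$ write $e\in\tilde v$ if $e\in E$ is one of the four edges bounding the face $\tilde v$; for $v\in V$ write $e\ni v$ if $v$ is an endpoint of $e$. Each edge $e$ carries $\mathcal{A}_e=M_2(\mathbb{C})$, with Pauli matrices $\sigma^x_e,\sigma^z_e\in\mathcal{A}_e$. For finite $\Lambda\subset E$, $\mathcal{A}_\Lambda=\bigotimes_{e\in\Lambda}\mathcal{A}_e$, with the natural inclusions $\mathcal{A}_{\Lambda'}\subset\mathcal{A}_\Lambda$ for $\Lambda'\subset\Lambda$; $\mathcal{A}$ is the $C^\ast$-completion of $\bigcup_\Lambda\mathcal{A}_\Lambda$ (so $\mathcal{A}\simeq M_{2^\infty}$). The star and face operators are $A_v=\prod_{e\ni v}\sigma^x_e$ and $B_{\tilde v}=\prod_{e\in\tilde v}\sigma^z_e$; they are pairwise commuting self-adjoint unitaries. *)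

theory Defs
  imports "HOL-Analysis.Analysis"
begin

section \<open>Unital C*-algebras\<close>

class cstar_algebra = real_normed_algebra_1 + complete_space +
  fixes scaleC :: "complex \<Rightarrow> 'a \<Rightarrow> 'a"  (infixr "*\<^sub>C" 75)
    and adj :: "'a \<Rightarrow> 'a"
  assumes scaleC_add_right: "c *\<^sub>C (x + y) = c *\<^sub>C x + c *\<^sub>C y"
    and scaleC_add_left: "(c + d) *\<^sub>C x = c *\<^sub>C x + d *\<^sub>C x"
    and scaleC_scaleC: "c *\<^sub>C d *\<^sub>C x = (c * d) *\<^sub>C x"
    and scaleR_scaleC: "r *\<^sub>R x = complex_of_real r *\<^sub>C x"
    and mult_scaleC_left: "(c *\<^sub>C x) * y = c *\<^sub>C (x * y)"
    and mult_scaleC_right: "x * (c *\<^sub>C y) = c *\<^sub>C (x * y)"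
    and norm_scaleC: "norm (c *\<^sub>C x) = cmod c * norm x"
    and adj_adj: "adj (adj x) = x"
    and adj_add: "adj (x + y) = adj x + adj y"
    and adj_scaleC: "adj (c *\<^sub>C x) = cnj c *\<^sub>C adj x"
    and adj_mult: "adj (x * y) = adj y * adj x"
    and norm_adj_mult: "norm (adj x * x) = (norm x)\<^sup>2"

definition sub_cstar_algebra :: "'a::cstar_algebra set \<Rightarrow> bool" where
  "sub_cstar_algebra B \<longleftrightarrow>
     0 \<in> B \<and> (\<forall>x\<in>B. \<forall>y\<in>B. x + y \<in> B \<and> x * y \<in> B) \<and>
     (\<forall>c. \<forall>x\<in>B. c *\<^sub>C x \<in> B) \<and> (\<forall>x\<in>B. adj x \<in> B) \<and> closed B"

definition cstar_generated :: "'a::cstar_algebra set \<Rightarrow> 'a set" where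
  "cstar_generated S = \<Inter> {B. sub_cstar_algebra B \<and> S \<subseteq> B}"

text \<open>Functionals on a sub-C*-algebra \<open>B\<close> are functions on the ambient type of which only the
  values on \<open>B\<close> matter. A state is a positive linear functional of norm one.\<close>

definition state_on :: "'a::cstar_algebra set \<Rightarrow> ('a \<Rightarrow> complex) \<Rightarrow> bool" where
  "state_on B \<phi> \<longleftrightarrow>
     (\<forall>x\<in>B. \<forall>y\<in>B. \<phi> (x + y) = \<phi> x + \<phi> y) \<and>
     (\<forall>c. \<forall>x\<in>B. \<phi> (c *\<^sub>C x) = c * \<phi> x) \<and>
     (\<forall>x\<in>B. \<phi> (adj x * x) \<in> \<real>\<^sub>\<ge>\<^sub>0) \<and>
     bdd_above ((\<lambda>x. cmod (\<phi> x)) ` {x \<in> B. norm x \<le> 1}) \<and>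
     (SUP x\<in>{x \<in> B. norm x \<le> 1}. cmod (\<phi> x)) = 1"

definition pure_state_on :: "'a::cstar_algebra set \<Rightarrow> ('a \<Rightarrow> complex) \<Rightarrow> bool" where
  "pure_state_on B \<phi> \<longleftrightarrow> state_on B \<phi> \<and>
     (\<forall>\<psi>\<^sub>1 \<psi>\<^sub>2 (t::real). state_on B \<psi>\<^sub>1 \<and> state_on B \<psi>\<^sub>2 \<and> 0 < t \<and> t < 1 \<and>
        (\<forall>x\<in>B. \<phi> x = of_real t * \<psi>\<^sub>1 x + of_real (1 - t) * \<psi>\<^sub>2 x) \<longrightarrow>
        (\<forall>x\<in>B. \<psi>\<^sub>1 x = \<phi> x \<and> \<psi>\<^sub>2 x = \<phi> x))"


section \<open>The square lattice\<close>

type_synonym vertex = "int \<times> int"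
type_synonym edge = "vertex set"

definition lattice_edges :: "edge set" where
  "lattice_edges = {{u, v} | u v. \<bar>fst u - fst v\<bar> + \<bar>snd u - snd v\<bar> = 1}"

lemma mem_lattice_edges:
  "\<bar>a - c\<bar> + \<bar>b - d\<bar> = 1 \<Longrightarrow> {(a, b), (c, d)} \<in> lattice_edges"
  unfolding lattice_edges_def by force

text \<open>A face is the set of its four corners. An edge bounds a face iff both its endpoints are
  corners of that face.\<close>

definition face :: "int \<Rightarrow> int \<Rightarrow> vertex set" where
  "face x y = {x, x + 1} \<times> {y, y + 1}"

lemma edges_at_vertex:
  "{e \<in> lattice_edges. (x, y) \<in> e} =
     {{(x, y), (x + 1, y)}, {(x, y), (x, y + 1)}, {(x, y), (x - 1, y)}, {(x, y), (x, y - 1)}}"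
    (is "?L = ?R")
proof
  show "?L \<subseteq> ?R"
  proof
    fix e assume e: "e \<in> ?L"
    then obtain u v where uv: "e = {u, v}" "\<bar>fst u - fst v\<bar> + \<bar>snd u - snd v\<bar> = 1"
      by (auto simp: lattice_edges_def)
    from e uv(1) have "u = (x, y) \<or> v = (x, y)" by auto
    then obtain a b where w: "e = {(x, y), (a, b)}" "\<bar>x - a\<bar> + \<bar>y - b\<bar> = 1"
    proof
      assume "u = (x, y)"
      then show ?thesis using uv that[of "fst v" "snd v"] by simp
    next
      assume "v = (x, y)"
      then show ?thesis using uv that[of "fst u" "snd u"]
        by (simp add: insert_commute abs_minus_commute)
    qed
    have "a = x + 1 \<and> b = y \<or> a = x \<and> b = y + 1 \<or> a = x - 1 \<and> b = y \<or> a = x \<and> b = y - 1"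
      using w(2) by (auto simp: abs_if split: if_split_asm)
    with w(1) show "e \<in> ?R" by blast
  qed
  show "?R \<subseteq> ?L"
    by (simp add: mem_lattice_edges)
qed

lemma edges_of_face:
  "{e \<in> lattice_edges. e \<subseteq> face x y} =
     {{(x, y), (x + 1, y)}, {(x + 1, y), (x + 1, y + 1)},
      {(x, y + 1), (x + 1, y + 1)}, {(x, y), (x, y + 1)}}"
    (is "?L = ?R")
proof
  show "?L \<subseteq> ?R"
  proof
    fix e assume "e \<in> ?L"
    then obtain a b c d where e: "e = {(a, b), (c, d)}" "\<bar>a - c\<bar> + \<bar>b - d\<bar> = 1"
      and "a = x \<or> a = x + 1" "b = y \<or> b = y + 1" "c = x \<or> c = x + 1" "d = y \<or> d = y + 1"
      by (auto simp: lattice_edges_def face_def)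
    then show "e \<in> ?R"
      by (elim disjE) (simp_all add: doubleton_eq_iff)
  qed
  show "?R \<subseteq> ?L"
    by (simp add: mem_lattice_edges face_def)
qed


section \<open>Local algebras\<close>

text \<open>The tensor product of copies of the 2 by 2 complex matrices over a finite edge set
  \<open>\<Lambda>\<close> is the algebra of complex matrices with rows and columns indexed by the spin configurations
  on \<open>\<Lambda>\<close>; matrices are extended by 0 to all other index pairs.\<close>

type_synonym config = "edge \<Rightarrow> 2"
type_synonym local_matrix = "config \<Rightarrow> config \<Rightarrow> complex"

definition configs :: "edge set \<Rightarrow> config set" where
  "configs \<Lambda> = \<Lambda> \<rightarrow>\<^sub>E UNIV"

definition local_algebra :: "edge set \<Rightarrow> local_matrix set" where
  "local_algebra \<Lambda> = {a. \<forall>s t. a s t \<noteq> 0 \<longrightarrow> s \<in> configs \<Lambda> \<and> t \<in> configs \<Lambda>}"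

definition local_one :: "edge set \<Rightarrow> local_matrix" where
  "local_one \<Lambda> = (\<lambda>s t. if s \<in> configs \<Lambda> \<and> s = t then 1 else 0)"

definition local_mult :: "edge set \<Rightarrow> local_matrix \<Rightarrow> local_matrix \<Rightarrow> local_matrix" where
  "local_mult \<Lambda> a b = (\<lambda>s t. \<Sum>u\<in>configs \<Lambda>. a s u * b u t)"

definition local_adj :: "local_matrix \<Rightarrow> local_matrix" where
  "local_adj a = (\<lambda>s t. cnj (a t s))"

text \<open>The natural inclusion for \<open>\<Lambda>' \<subseteq> \<Lambda>\<close>, tensoring with the identity on \<open>\<Lambda> - \<Lambda>'\<close>.\<close>

definition local_incl :: "edge set \<Rightarrow> edge set \<Rightarrow> local_matrix \<Rightarrow> local_matrix" where
  "local_incl \<Lambda>' \<Lambda> a = (\<lambda>s t.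
     if s \<in> configs \<Lambda> \<and> t \<in> configs \<Lambda> \<and> (\<forall>e\<in>\<Lambda> - \<Lambda>'. s e = t e)
     then a (restrict s \<Lambda>') (restrict t \<Lambda>') else 0)"

text \<open>The identification of a 2 by 2 matrix with an element of the algebra of the single edge
  \<open>e\<close>.\<close>

definition site_matrix :: "edge \<Rightarrow> complex^2^2 \<Rightarrow> local_matrix" where
  "site_matrix e m =
     (\<lambda>s t. if s \<in> configs {e} \<and> t \<in> configs {e} then m $ s e $ t e else 0)"

definition pauli_x :: "complex^2^2" where
  "pauli_x = vector [vector [0, 1], vector [1, 0]]"

definition pauli_z :: "complex^2^2" where
  "pauli_z = vector [vector [1, 0], vector [0, -1]]"


section \<open>The quasi-local algebra\<close>

text \<open>A C*-completion of the union of the local algebras: a C*-algebra into which the inductive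
  system of local algebras embeds, compatibly with the natural inclusions, with dense union. A full
  matrix algebra carries only one C*-norm, so the embeddings are isometric and the completion is
  determined up to isomorphism.\<close>

locale quasi_local_algebra =
  fixes \<iota> :: "edge set \<Rightarrow> local_matrix \<Rightarrow> 'a::cstar_algebra"
  assumes embed_add: "\<lbrakk>finite \<Lambda>; \<Lambda> \<subseteq> lattice_edges; a \<in> local_algebra \<Lambda>; b \<in> local_algebra \<Lambda>\<rbrakk>
      \<Longrightarrow> \<iota> \<Lambda> (\<lambda>s t. a s t + b s t) = \<iota> \<Lambda> a + \<iota> \<Lambda> b"
    and embed_scale: "\<lbrakk>finite \<Lambda>; \<Lambda> \<subseteq> lattice_edges; a \<in> local_algebra \<Lambda>\<rbrakk>
      \<Longrightarrow> \<iota> \<Lambda> (\<lambda>s t. c * a s t) = c *\<^sub>C \<iota> \<Lambda> a"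
    and embed_mult: "\<lbrakk>finite \<Lambda>; \<Lambda> \<subseteq> lattice_edges; a \<in> local_algebra \<Lambda>; b \<in> local_algebra \<Lambda>\<rbrakk>
      \<Longrightarrow> \<iota> \<Lambda> (local_mult \<Lambda> a b) = \<iota> \<Lambda> a * \<iota> \<Lambda> b"
    and embed_one: "\<lbrakk>finite \<Lambda>; \<Lambda> \<subseteq> lattice_edges\<rbrakk> \<Longrightarrow> \<iota> \<Lambda> (local_one \<Lambda>) = 1"
    and embed_adj: "\<lbrakk>finite \<Lambda>; \<Lambda> \<subseteq> lattice_edges; a \<in> local_algebra \<Lambda>\<rbrakk>
      \<Longrightarrow> \<iota> \<Lambda> (local_adj a) = adj (\<iota> \<Lambda> a)"
    and embed_inj: "\<lbrakk>finite \<Lambda>; \<Lambda> \<subseteq> lattice_edges\<rbrakk> \<Longrightarrow> inj_on (\<iota> \<Lambda>) (local_algebra \<Lambda>)"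
    and embed_incl: "\<lbrakk>finite \<Lambda>; \<Lambda> \<subseteq> lattice_edges; \<Lambda>' \<subseteq> \<Lambda>; a \<in> local_algebra \<Lambda>'\<rbrakk>
      \<Longrightarrow> \<iota> \<Lambda> (local_incl \<Lambda>' \<Lambda> a) = \<iota> \<Lambda>' a"
    and embed_dense:
      "closure (\<Union>\<Lambda>\<in>{\<Lambda>. finite \<Lambda> \<and> \<Lambda> \<subseteq> lattice_edges}. \<iota> \<Lambda> ` local_algebra \<Lambda>) = UNIV"


section \<open>Star and face operators\<close>

definition sigma_x :: "(edge set \<Rightarrow> local_matrix \<Rightarrow> 'a) \<Rightarrow> edge \<Rightarrow> 'a" where
  "sigma_x \<iota> e = \<iota> {e} (site_matrix e pauli_x)"

definition sigma_z :: "(edge set \<Rightarrow> local_matrix \<Rightarrow> 'a) \<Rightarrow> edge \<Rightarrow> 'a" where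
  "sigma_z \<iota> e = \<iota> {e} (site_matrix e pauli_z)"

text \<open>The factors sit on distinct edges and hence commute, so the order chosen below is immaterial;
  they run over the edges listed in \<open>edges_at_vertex\<close> and \<open>edges_of_face\<close>.\<close>

definition star_operator :: "(edge set \<Rightarrow> local_matrix \<Rightarrow> 'a::cstar_algebra) \<Rightarrow> int \<Rightarrow> int \<Rightarrow> 'a" where
  "star_operator \<iota> x y =
     sigma_x \<iota> {(x, y), (x + 1, y)} * sigma_x \<iota> {(x, y), (x, y + 1)} *
     sigma_x \<iota> {(x, y), (x - 1, y)} * sigma_x \<iota> {(x, y), (x, y - 1)}"

definition face_operator :: "(edge set \<Rightarrow> local_matrix \<Rightarrow> 'a::cstar_algebra) \<Rightarrow> int \<Rightarrow> int \<Rightarrow> 'a" where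
  "face_operator \<iota> x y =
     sigma_z \<iota> {(x, y), (x + 1, y)} * sigma_z \<iota> {(x + 1, y), (x + 1, y + 1)} *
     sigma_z \<iota> {(x, y + 1), (x + 1, y + 1)} * sigma_z \<iota> {(x, y), (x, y + 1)}"

definition star_face_algebra :: "(edge set \<Rightarrow> local_matrix \<Rightarrow> 'a::cstar_algebra) \<Rightarrow> 'a set" where
  "star_face_algebra \<iota> = cstar_generated
     ({star_operator \<iota> x y | x y. True} \<union> {face_operator \<iota> x y | x y. True})"

end

theory Submission imports Defs begin

text \<open>A pure state \<open>\<omega>\<close> of the commutative algebra \<open>C\<close> takes the values \<open>\<plusminus>1\<close> on the star and face
  operators. By Cauchy-Schwarz a state \<open>\<phi>\<close> extending \<open>\<omega>\<close> then satisfies \<open>\<phi>(u x) = \<omega>(u) \<phi>(x) = \<phi>(x u)\<close> for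
  each such operator \<open>u\<close>, so it vanishes on every product \<open>g\<close> of Pauli matrices anticommuting with
  some \<open>u\<close>. If \<open>g\<close> commutes with all of them, its \<open>\<sigma>\<^sup>z\<close> part is supported on a finite cycle and its
  \<open>\<sigma>\<^sup>x\<close> part on a finite cocycle; the plane has no homology, so \<open>g\<close> is up to sign a product of star and
  face operators and lies in \<open>C\<close>. As these products span a dense subspace, there is at most one
  extension, and it is pure because \<open>\<omega>\<close> is. For existence one compresses by the local projections
  \<open>p\<close> of \<open>C\<close> with \<open>\<omega>(p) = 1\<close>: for each local \<open>x\<close> some \<open>p x p\<close> is a multiple of \<open>p\<close>, and the
  multiples define the extension.\<close>

section \<open>C*-algebras and positive functionals\<close>

text \<open>The values \<plusminus>1 come from convexity: (1 + s u)/2 is a projection commuting with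
  all of \<open>C\<close>, and a pure state giving it a value strictly between 0 and 1 would be a
  proper mixture of its compressions by the projection and by its complement. Projections of value 1
  are closed under products, so any two compressions have a common refinement; this makes the
  extension well defined and additive, in place of a Hahn-Banach argument. Their norm is 1, so it is
  contractive and passes from local elements to limits. Positivity is decided inside finite matrix
  algebras, where y* y = c p with a nonzero projection p forces c \<ge> 0, and carried over by
  continuity. Uniqueness is proved among all states: a decomposition of the extension restricts to
  one of \<omega>, so its two parts agree with \<omega> on \<open>C\<close> and hence with the
  extension. One sweeping argument serves cycles and cocycles alike, since lattice duality exchanges
  them. Finite support is essential: an infinite line is a cycle that bounds no finite set of
  faces.\<close>

lemma scaleC_minus_one: "(-1) *\<^sub>C x = - (x::'a::cstar_algebra)"
  using scaleR_scaleC[of "-1" x] by simp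

lemma scaleC_zero_left: "0 *\<^sub>C x = (0::'a::cstar_algebra)"
  using scaleR_scaleC[of 0 x] by simp

lemma scaleC_minus_right: "c *\<^sub>C (- x) = - (c *\<^sub>C (x::'a::cstar_algebra))"
  by (metis mult_scaleC_left mult_scaleC_right scaleC_minus_one mult_1_right mult_minus_right)

lemma scaleC_diff_right: "c *\<^sub>C (x - y) = c *\<^sub>C x - c *\<^sub>C (y::'a::cstar_algebra)"
  using scaleC_add_right[of c x "-y"] by (simp add: scaleC_minus_right)

lemma scaleC_diff_left: "(c - d) *\<^sub>C x = c *\<^sub>C x - d *\<^sub>C (x::'a::cstar_algebra)"
  using scaleC_add_left[of "c - d" d x] by simp

lemma adj_one: "adj 1 = (1::'a::cstar_algebra)"
  by (metis adj_adj adj_mult mult_1_right)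

lemma adj_scaleR: "adj (r *\<^sub>R x) = r *\<^sub>R adj (x::'a::cstar_algebra)"
  by (simp add: scaleR_scaleC adj_scaleC)

lemma adj_minus: "adj (- x) = - adj (x::'a::cstar_algebra)"
  using adj_scaleR[of "-1" x] by simp

lemma adj_diff: "adj (x - y) = adj x - adj (y::'a::cstar_algebra)"
  using adj_add[of x "-y"] by (simp add: adj_minus)

lemma norm_adj: "norm (adj x) = norm (x::'a::cstar_algebra)"
proof -
  have *: "norm x \<le> norm (adj x)" for x :: 'a
  proof (cases "x = 0")
    case False
    have "(norm x)\<^sup>2 \<le> norm (adj x) * norm x"
      using norm_mult_ineq[of "adj x" x] by (simp add: norm_adj_mult)
    then show ?thesis using False by (simp add: power2_eq_square)
  qed simp
  show ?thesis using *[of x] *[of "adj x"] by (simp add: adj_adj)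
qed

lemma bounded_linear_adj: "bounded_linear (adj :: 'a::cstar_algebra \<Rightarrow> 'a)"
  by (rule bounded_linear_intro[where K = 1]) (simp_all add: adj_add adj_scaleR norm_adj)

lemma continuous_on_adj [continuous_intros]:
  "continuous_on S f \<Longrightarrow> continuous_on S (\<lambda>x. adj (f x :: 'a::cstar_algebra))"
  by (rule bounded_linear.continuous_on[OF bounded_linear_adj])

lemma norm_projection:
  fixes p :: "'a::cstar_algebra"
  assumes "adj p = p" "p * p = p" "p \<noteq> 0"
  shows "norm p = 1"
  using norm_adj_mult[of p] assms by (simp add: power2_eq_square)

section \<open>Sub-C*-algebras and commutants\<close>

lemma sub_cstar_algebraD:
  assumes "sub_cstar_algebra B"
  shows "0 \<in> B" "x \<in> B \<Longrightarrow> y \<in> B \<Longrightarrow> x + y \<in> B" "x \<in> B \<Longrightarrow> y \<in> B \<Longrightarrow> x * y \<in> B"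
    "x \<in> B \<Longrightarrow> c *\<^sub>C x \<in> B" "x \<in> B \<Longrightarrow> adj x \<in> B" "closed B"
  using assms by (auto simp: sub_cstar_algebra_def)

lemma sub_cstar_algebra_minus:
  assumes "sub_cstar_algebra B" "x \<in> B"
  shows "- x \<in> B"
  using sub_cstar_algebraD(4)[OF assms, of "-1"] by (simp add: scaleC_minus_one)

lemma sub_cstar_algebra_diff:
  assumes "sub_cstar_algebra B" "x \<in> B" "y \<in> B"
  shows "x - y \<in> B"
  using sub_cstar_algebraD(2)[OF assms(1,2) sub_cstar_algebra_minus[OF assms(1,3)]] by simp

lemma sub_cstar_algebra_scaleR:
  assumes "sub_cstar_algebra B" "x \<in> B"
  shows "r *\<^sub>R x \<in> B"
  using sub_cstar_algebraD(4)[OF assms] by (simp add: scaleR_scaleC)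

lemma sub_cstar_algebra_UNIV: "sub_cstar_algebra UNIV"
  by (simp add: sub_cstar_algebra_def)

lemma sub_cstar_algebra_generated: "sub_cstar_algebra (cstar_generated S)"
  unfolding cstar_generated_def sub_cstar_algebra_def by (auto intro!: closed_Inter)

lemma generated_superset: "S \<subseteq> cstar_generated S"
  unfolding cstar_generated_def by auto

lemma generated_least: "sub_cstar_algebra B \<Longrightarrow> S \<subseteq> B \<Longrightarrow> cstar_generated S \<subseteq> B"
  unfolding cstar_generated_def by auto

text \<open>Closure of \<open>G\<close> under the adjoint makes the commutant self-adjoint; it is
  norm closed because each commutation relation is an equation between continuous maps.\<close>

lemma sub_cstar_algebra_commutant:
  fixes G :: "'a::cstar_algebra set"
  assumes "\<And>g. g \<in> G \<Longrightarrow> adj g \<in> G"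
  shows "sub_cstar_algebra {x. \<forall>g\<in>G. x * g = g * x}"
  unfolding sub_cstar_algebra_def
proof (intro conjI ballI allI)
  let ?K = "{x. \<forall>g\<in>G. x * g = g * x}"
  show "adj x \<in> ?K" if "x \<in> ?K" for x
  proof clarify
    fix g assume "g \<in> G"
    then have "x * adj g = adj g * x" using that assms by blast
    then have "adj (x * adj g) = adj (adj g * x)" by simp
    then show "adj x * g = g * adj x" by (simp add: adj_mult adj_adj)
  qed
  have "?K = (\<Inter>g\<in>G. {x. x * g = g * x})" by blast
  moreover have "closed {x. x * g = g * x}" for g :: 'a
    by (intro closed_Collect_eq continuous_intros)
  ultimately show "closed ?K" by auto
  show "x * y \<in> ?K" if "x \<in> ?K" "y \<in> ?K" for x y
    using that by clarsimp (metis mult.assoc)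
qed (auto simp: algebra_simps mult_scaleC_left mult_scaleC_right)

text \<open>The commutant is used twice: commuting generators put the generated algebra in the
  commutant of \<open>G\<close>, hence \<open>G\<close> in the commutant of the algebra, and then
  the algebra in its own commutant.\<close>

lemma generated_commutative:
  fixes G :: "'a::cstar_algebra set"
  assumes adj: "\<And>g. g \<in> G \<Longrightarrow> adj g = g"
    and comm: "\<And>g h. g \<in> G \<Longrightarrow> h \<in> G \<Longrightarrow> g * h = h * g"
    and "x \<in> cstar_generated G" "y \<in> cstar_generated G"
  shows "x * y = y * x"
proof -
  let ?C = "cstar_generated G"
  have "?C \<subseteq> {x. \<forall>g\<in>G. x * g = g * x}"
    by (rule generated_least[OF sub_cstar_algebra_commutant]) (auto simp: adj comm)
  then have "?C \<subseteq> {x. \<forall>g\<in>?C. x * g = g * x}"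
    by (intro generated_least[OF sub_cstar_algebra_commutant])
      (auto simp: sub_cstar_algebraD(5)[OF sub_cstar_algebra_generated])
  then show ?thesis using assms by blast
qed

section \<open>Positive functionals and their norms\<close>

definition positive_functional_on :: "'a::cstar_algebra set \<Rightarrow> ('a \<Rightarrow> complex) \<Rightarrow> bool" where
  "positive_functional_on B f \<longleftrightarrow>
     (\<forall>x\<in>B. \<forall>y\<in>B. f (x + y) = f x + f y) \<and>
     (\<forall>c. \<forall>x\<in>B. f (c *\<^sub>C x) = c * f x) \<and>
     (\<forall>x\<in>B. f (adj x * x) \<in> \<real>\<^sub>\<ge>\<^sub>0) \<and>
     bdd_above ((\<lambda>x. cmod (f x)) ` {x \<in> B. norm x \<le> 1})"

locale positive_functional =
  fixes B :: "'a::cstar_algebra set" and f :: "'a \<Rightarrow> complex"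
  assumes B: "sub_cstar_algebra B" and one: "1 \<in> B" and f: "positive_functional_on B f"
begin

lemmas B_intros = sub_cstar_algebraD[OF B] sub_cstar_algebra_minus[OF B] sub_cstar_algebra_diff[OF B]
  sub_cstar_algebra_scaleR[OF B] one

lemma add: "x \<in> B \<Longrightarrow> y \<in> B \<Longrightarrow> f (x + y) = f x + f y"
  and scale: "x \<in> B \<Longrightarrow> f (c *\<^sub>C x) = c * f x"
  and pos: "x \<in> B \<Longrightarrow> f (adj x * x) \<in> \<real>\<^sub>\<ge>\<^sub>0"
  and bdd: "bdd_above ((\<lambda>x. cmod (f x)) ` {x \<in> B. norm x \<le> 1})"
  using f by (auto simp: positive_functional_on_def)

lemma minus: "x \<in> B \<Longrightarrow> f (- x) = - f x"
  using scale[of x "-1"] by (simp add: scaleC_minus_one)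

lemma diff: "x \<in> B \<Longrightarrow> y \<in> B \<Longrightarrow> f (x - y) = f x - f y"
  using add[of x "-y"] minus[of y] B_intros by simp

lemma scaleR: "x \<in> B \<Longrightarrow> f (r *\<^sub>R x) = of_real r * f x"
  by (simp add: scaleR_scaleC scale)

lemma expand:
  assumes "x \<in> B" "y \<in> B"
  shows "f (adj (x + c *\<^sub>C y) * (x + c *\<^sub>C y)) =
    f (adj x * x) + c * f (adj x * y) + cnj c * f (adj y * x) + of_real ((cmod c)\<^sup>2) * f (adj y * y)"
proof -
  have "adj (x + c *\<^sub>C y) * (x + c *\<^sub>C y) =
    adj x * x + c *\<^sub>C (adj x * y) + cnj c *\<^sub>C (adj y * x) + (cnj c * c) *\<^sub>C (adj y * y)"
    by (simp add: adj_add adj_scaleC distrib_left distrib_right mult_scaleC_left mult_scaleC_right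
        scaleC_scaleC scaleC_add_right mult.commute add.assoc add.left_commute)
  moreover have "cnj c * c = of_real ((cmod c)\<^sup>2)"
    by (metis complex_norm_square mult.commute)
  ultimately show ?thesis
    using assms by (simp add: add scale B_intros)
qed

text \<open>Polarization: \<open>f\<close> is real at the squares of x + y and x + i y, whose cross
  terms give the imaginary and the real part of the identity.\<close>

lemma hermitian:
  assumes x: "x \<in> B" and y: "y \<in> B"
  shows "f (adj x * y) = cnj (f (adj y * x))"
proof -
  have r: "f (adj z * z) \<in> \<real>" if "z \<in> B" for z
    using pos[OF that] by (simp add: complex_nonneg_Reals_iff complex_is_Real_iff)
  have "x + c *\<^sub>C y \<in> B" for c using assms B_intros by simp
  from r[OF this] have e: "Im (c * f (adj x * y) + cnj c * f (adj y * x)) = 0" for c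
    using r[OF x] r[OF y] by (simp add: expand[OF x y] complex_is_Real_iff)
  from e[of 1] e[of \<i>] show ?thesis by (simp add: complex_eq_iff)
qed

lemma Cauchy_Schwarz:
  assumes x: "x \<in> B" and y: "y \<in> B"
  shows "(cmod (f (adj y * x)))\<^sup>2 \<le> Re (f (adj x * x)) * Re (f (adj y * y))"
proof -
  define a b k where "a = Re (f (adj x * x))" and "b = Re (f (adj y * y))" and "k = f (adj y * x)"
  have b0: "0 \<le> b" using pos[OF y] by (simp add: b_def complex_nonneg_Reals_iff)
  have q: "0 \<le> a - 2 * r * (cmod k)\<^sup>2 + r\<^sup>2 * (cmod k)\<^sup>2 * b" for r :: real
  proof -
    \<comment> \<open>The factor \<open>k\<close> aligns the phases, so that both cross terms become
      the same real number and the form is a real quadratic in \<open>r\<close>.\<close>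
    define c where "c = - of_real r * k"
    have "x + c *\<^sub>C y \<in> B" using assms B_intros by simp
    from pos[OF this] have "0 \<le> Re (f (adj (x + c *\<^sub>C y) * (x + c *\<^sub>C y)))"
      by (simp add: complex_nonneg_Reals_iff)
    also have "\<dots> = a + Re (c * cnj k) + Re (cnj c * k) + (cmod c)\<^sup>2 * b"
      by (simp add: expand[OF x y] a_def b_def k_def hermitian[OF x y] del: of_real_power)
    also have "Re (c * cnj k) = - (r * (cmod k)\<^sup>2)"
      by (simp only: cmod_power2) (simp add: c_def power2_eq_square algebra_simps)
    also have "Re (cnj c * k) = - (r * (cmod k)\<^sup>2)"
      by (simp only: cmod_power2) (simp add: c_def power2_eq_square algebra_simps)
    also have "(cmod c)\<^sup>2 = r\<^sup>2 * (cmod k)\<^sup>2"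
      by (simp add: c_def norm_mult power_mult_distrib)
    finally show ?thesis by simp
  qed
  have "(cmod k)\<^sup>2 \<le> a * b"
  proof (cases "b = 0")
    case False
    then show ?thesis using q[of "1 / b"] b0 by (simp add: field_simps power2_eq_square)
  next
    case True
    have "cmod k = 0"
    proof (rule ccontr)
      assume "cmod k \<noteq> 0"
      \<comment> \<open>For b = 0 the quadratic is linear in \<open>r\<close>, and this choice gives
        it the value -1.\<close>
      then show False using q[of "(a + 1) / (2 * (cmod k)\<^sup>2)"] True by simp
    qed
    then show ?thesis using True by simp
  qed
  then show ?thesis by (simp add: a_def b_def k_def)
qed

lemma f_one: "f 1 = of_real (Re (f 1))" "0 \<le> Re (f 1)"
  using pos[OF one] by (simp_all add: adj_one complex_nonneg_Reals_iff complex_eq_iff)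

text \<open>Let K be the norm of \<open>f\<close>. Cauchy-Schwarz against 1, together with the
  C*-identity that keeps x* x in the unit ball, bounds the square of K by f(1) K, so K \<le>
  f(1).\<close>

lemma cmod_le:
  assumes "x \<in> B"
  shows "cmod (f x) \<le> Re (f 1) * norm x"
proof -
  define K where "K = (SUP x\<in>{x \<in> B. norm x \<le> 1}. cmod (f x))"
  have K: "cmod (f x) \<le> K" if "x \<in> B" "norm x \<le> 1" for x
    unfolding K_def by (rule cSUP_upper[OF _ bdd]) (use that in simp)
  have K0: "0 \<le> K" using order_trans[OF norm_ge_zero K[OF one]] by simp
  have le: "(cmod (f x))\<^sup>2 \<le> Re (f 1) * K" if x: "x \<in> B" "norm x \<le> 1" for x
  proof -
    have "(cmod (f x))\<^sup>2 \<le> Re (f (adj x * x)) * Re (f 1)"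
      using Cauchy_Schwarz[OF x(1) one] by (simp add: adj_one)
    also have "Re (f (adj x * x)) \<le> cmod (f (adj x * x))" by (rule complex_Re_le_cmod)
    also have "\<dots> \<le> K"
      using x by (intro K) (simp_all add: B_intros norm_adj_mult power_le_one)
    finally show ?thesis using f_one(2) by (simp add: mult.commute mult_right_mono)
  qed
  have "K \<le> sqrt (Re (f 1) * K)"
    unfolding K_def
  proof (rule cSUP_least)
    show "{x \<in> B. norm x \<le> 1} \<noteq> {}" using one by auto
    show "cmod (f x) \<le> sqrt (Re (f 1) * (SUP x\<in>{x \<in> B. norm x \<le> 1}. cmod (f x)))"
      if "x \<in> {x \<in> B. norm x \<le> 1}" for x
      using le[of x] that by (simp add: real_le_rsqrt K_def)
  qed
  then have "K\<^sup>2 \<le> Re (f 1) * K"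
    by (meson K0 f_one(2) mult_nonneg_nonneg real_sqrt_ge_zero real_sqrt_le_iff real_le_lsqrt
        power_mono real_sqrt_pow2 order.trans)
  then have K1: "K \<le> Re (f 1)"
    using K0 f_one(2) by (cases "K = 0") (auto simp: power2_eq_square)
  show ?thesis
  proof (cases "x = 0")
    case True
    then show ?thesis using scale[OF one, of 0] by (simp add: scaleC_zero_left)
  next
    case False
    have "cmod (f ((1 / norm x) *\<^sub>R x)) \<le> K"
      using assms False by (intro K) (simp_all add: B_intros)
    then have "cmod (f x) \<le> K * norm x"
      using assms False by (simp add: scaleR norm_mult norm_divide field_simps)
    also have "\<dots> \<le> Re (f 1) * norm x" using K1 by (simp add: mult_right_mono)
    finally show ?thesis .
  qed
qed

end

text \<open>The norm of a positive functional is its value at 1, by \<open>cmod_le\<close> and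
  evaluation at 1. The norm condition becomes an equation that is immediate to check for
  restrictions and compressions.\<close>

lemma state_on_iff:
  fixes B :: "'a::cstar_algebra set"
  assumes B: "sub_cstar_algebra B" "1 \<in> B"
  shows "state_on B f \<longleftrightarrow> positive_functional_on B f \<and> f 1 = 1"
proof (cases "positive_functional_on B f")
  case True
  interpret positive_functional B f by unfold_locales (use B True in auto)
  have "(SUP x\<in>{x \<in> B. norm x \<le> 1}. cmod (f x)) = Re (f 1)"
  proof (rule antisym)
    show "(SUP x\<in>{x \<in> B. norm x \<le> 1}. cmod (f x)) \<le> Re (f 1)"
    proof (rule cSUP_least)
      fix x assume "x \<in> {x \<in> B. norm x \<le> 1}"
      then show "cmod (f x) \<le> Re (f 1)"
        using cmod_le[of x] mult_left_le[of "norm x" "Re (f 1)"] f_one(2) by simp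
    qed (use one in auto)
    have "cmod (f 1) \<le> (SUP x\<in>{x \<in> B. norm x \<le> 1}. cmod (f x))"
      by (rule cSUP_upper[OF _ bdd]) (use one in simp)
    then show "Re (f 1) \<le> (SUP x\<in>{x \<in> B. norm x \<le> 1}. cmod (f x))"
      using complex_Re_le_cmod[of "f 1"] by simp
  qed
  moreover have "Re (f 1) = 1 \<longleftrightarrow> f 1 = 1"
    using f_one(1) by (metis of_real_1 one_complex.simps(1))
  ultimately show ?thesis
    using True by (simp add: state_on_def positive_functional_on_def)
next
  case False
  then show ?thesis by (auto simp: state_on_def positive_functional_on_def)
qed

text \<open>The zero vector has no rule of its own; it arises as 0 times a member, so inductions
  have only three cases.\<close>

inductive_set complex_span :: "'a::cstar_algebra set \<Rightarrow> 'a set" for G where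
  base: "x \<in> G \<Longrightarrow> x \<in> complex_span G"
| add: "x \<in> complex_span G \<Longrightarrow> y \<in> complex_span G \<Longrightarrow> x + y \<in> complex_span G"
| scale: "x \<in> complex_span G \<Longrightarrow> c *\<^sub>C x \<in> complex_span G"

section \<open>Projections, symmetries and compressed states\<close>

definition projection :: "'a::cstar_algebra \<Rightarrow> bool" where
  "projection p \<longleftrightarrow> adj p = p \<and> p * p = p"

definition symmetry :: "'a::cstar_algebra \<Rightarrow> bool" where
  "symmetry u \<longleftrightarrow> adj u = u \<and> u * u = 1"

text \<open>For a symmetry \<open>u\<close> and \<open>s\<close> = \<plusminus>1 this is the
  spectral projection of \<open>u\<close> for the eigenvalue \<open>s\<close>.\<close>

definition spectral_projection :: "'a::cstar_algebra \<Rightarrow> real \<Rightarrow> 'a" where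
  "spectral_projection u s = (1/2) *\<^sub>R (1 + s *\<^sub>R u)"

lemma projection_spectral:
  assumes "symmetry u" "s \<in> {1, -1}"
  shows "projection (spectral_projection u s)"
proof -
  have "(1 + s *\<^sub>R u) * (1 + s *\<^sub>R u) = 2 *\<^sub>R (1 + s *\<^sub>R u)"
    using assms by (auto simp: symmetry_def algebra_simps scaleR_2)
  then show ?thesis
    using assms(1) by (simp add: projection_def spectral_projection_def adj_scaleR adj_add adj_one symmetry_def)
qed

lemma symmetry_mult_spectral:
  assumes "symmetry u" "s \<in> {1, -1}"
  shows "u * spectral_projection u s = s *\<^sub>R spectral_projection u s"
    "spectral_projection u s * u = s *\<^sub>R spectral_projection u s"
  using assms by (auto simp: symmetry_def spectral_projection_def algebra_simps)

lemma projection_diff: "projection p \<Longrightarrow> projection (1 - p)"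
  by (simp add: projection_def adj_diff adj_one algebra_simps)

lemma projection_mult: "projection p \<Longrightarrow> projection q \<Longrightarrow> p * q = q * p \<Longrightarrow> projection (p * q)"
  unfolding projection_def by (metis adj_mult mult.assoc)

lemma norm_projection_le:
  assumes "projection p"
  shows "norm p \<le> 1"
proof (cases "p = 0")
  case False
  then show ?thesis using norm_projection[of p] assms by (simp add: projection_def)
qed simp

context positive_functional
begin

lemma null_mult:
  assumes "x \<in> B" "y \<in> B" "f (adj y * y) = 0"
  shows "f (adj y * x) = 0" "f (adj x * y) = 0"
proof -
  show "f (adj y * x) = 0" using Cauchy_Schwarz[OF assms(1,2)] assms(3) by simp
  then show "f (adj x * y) = 0" using hermitian[OF assms(1,2)] by simp
qed

text \<open>The complement \<open>1 - p\<close> is a null vector of \<open>f\<close>, and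
  Cauchy-Schwarz kills every product with it on either side.\<close>

lemma projection_absorb:
  assumes "x \<in> B" "p \<in> B" "projection p" "f p = f 1"
  shows "f (p * x) = f x" "f (x * p) = f x"
proof -
  have q: "projection (1 - p)" by (rule projection_diff[OF assms(3)])
  have B': "1 - p \<in> B" using assms by (simp add: B_intros)
  have "f (adj (1 - p) * (1 - p)) = 0"
    using q assms by (simp add: projection_def diff B_intros)
  note n = null_mult[OF _ B' this]
  have "f ((1 - p) * x) = 0" using n(1)[OF assms(1)] q by (simp add: projection_def)
  then show "f (p * x) = f x" using assms by (simp add: left_diff_distrib diff B_intros)
  have "f (x * (1 - p)) = 0" using n(2)[of "adj x"] assms by (simp add: adj_adj B_intros)
  then show "f (x * p) = f x" using assms by (simp add: right_diff_distrib diff B_intros)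
qed

text \<open>The hypothesis on \<open>f u\<close> says that \<open>f\<close> takes the value f(1) at
  the spectral projection for \<open>s\<close>. Inserting that projection changes nothing, and
  beside it \<open>u\<close> may be replaced by \<open>s\<close>.\<close>

lemma symmetry_absorb:
  assumes "x \<in> B" "u \<in> B" "symmetry u" "f u = of_real s * f 1" "s \<in> {1, -1}"
  shows "f (u * x) = of_real s * f x" "f (x * u) = of_real s * f x"
proof -
  let ?p = "spectral_projection u s"
  have p: "?p \<in> B" using assms(2) by (simp add: spectral_projection_def B_intros)
  have "f ?p = f 1"
    using assms by (auto simp: spectral_projection_def scaleR add minus B_intros field_simps)
  note a = projection_absorb[OF _ p projection_spectral[OF assms(3,5)] this]
  have "f (u * x) = f (?p * (u * x))" using a(1)[of "u * x"] assms by (simp add: B_intros)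
  also have "\<dots> = f (s *\<^sub>R (?p * x))"
    by (simp add: mult.assoc[symmetric] symmetry_mult_spectral[OF assms(3,5)])
  also have "\<dots> = of_real s * f x" using a(1)[OF assms(1)] assms p by (simp add: scaleR B_intros)
  finally show "f (u * x) = of_real s * f x" .
  have "f (x * u) = f ((x * u) * ?p)" using a(2)[of "x * u"] assms by (simp add: B_intros)
  also have "\<dots> = f (s *\<^sub>R (x * ?p))"
    by (simp add: mult.assoc symmetry_mult_spectral[OF assms(3,5)])
  also have "\<dots> = of_real s * f x" using a(2)[OF assms(1)] assms p by (simp add: scaleR B_intros)
  finally show "f (x * u) = of_real s * f x" .
qed

lemma anticommute_zero:
  assumes "x \<in> B" "u \<in> B" "symmetry u" "f u = of_real s * f 1" "s \<in> {1, -1}" "u * x = - (x * u)"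
  shows "f x = 0"
proof -
  have "of_real s * f x = - (of_real s * f x)"
    using symmetry_absorb[OF assms(1-5)] assms by (simp add: minus B_intros)
  then show ?thesis using assms(5) by auto
qed

end

text \<open>Positivity survives because \<open>p\<close> commutes with \<open>B\<close>: compressing
  \<open>adj x * x\<close> by \<open>p\<close> gives \<open>adj (x * p) * (x * p)\<close>.\<close>

lemma (in positive_functional) state_on_compress:
  assumes p: "p \<in> B" "projection p" "\<And>x. x \<in> B \<Longrightarrow> p * x = x * p" and "f p \<noteq> 0"
  shows "state_on B (\<lambda>x. f (p * x) / f p)"
proof -
  have pp: "f (p * (adj x * x)) = f (adj (x * p) * (x * p))" if "x \<in> B" for x
  proof -
    have "adj (x * p) * (x * p) = p * (adj x * (x * p))"
      using p(2) by (simp add: adj_mult mult.assoc projection_def)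
    also have "\<dots> = p * ((p * adj x) * x)"
      using p(3)[OF that] p(3)[of "adj x"] that by (simp add: mult.assoc B_intros)
    also have "\<dots> = p * (adj x * x)"
      using p(2) by (simp add: mult.assoc[symmetric] projection_def)
    finally show ?thesis by simp
  qed
  have fp: "f p \<in> \<real>\<^sub>\<ge>\<^sub>0" using pos[OF p(1)] p(2) by (simp add: projection_def)
  have "positive_functional_on B (\<lambda>x. f (p * x) / f p)"
    unfolding positive_functional_on_def
  proof (intro conjI ballI allI)
    show "f (p * (adj x * x)) / f p \<in> \<real>\<^sub>\<ge>\<^sub>0" if "x \<in> B" for x
      unfolding pp[OF that] using that p(1) fp by (intro nonneg_Reals_divide_I pos B_intros)
    show "bdd_above ((\<lambda>x. cmod (f (p * x) / f p)) ` {x \<in> B. norm x \<le> 1})"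
    proof (rule bdd_aboveI2)
      fix x assume x: "x \<in> {x \<in> B. norm x \<le> 1}"
      then have "cmod (f (p * x)) \<le> Re (f 1) * norm (p * x)"
        using p by (intro cmod_le) (simp add: B_intros)
      also have "\<dots> \<le> Re (f 1) * 1"
        using x norm_projection_le[OF p(2)] f_one(2)
        by (intro mult_left_mono order_trans[OF norm_mult_ineq] mult_le_one) auto
      finally show "cmod (f (p * x) / f p) \<le> Re (f 1) / cmod (f p)"
        by (simp add: norm_divide divide_right_mono)
    qed
  qed (use p(1) in \<open>auto simp: distrib_left add B_intros mult_scaleC_right scale add_divide_distrib\<close>)
  then show ?thesis
    using assms by (simp add: state_on_iff[OF B one])
qed

text \<open>\<omega> is the mixture of its compressions by \<open>p\<close> and
  \<open>1 - p\<close>, with weights \<omega>(p) and 1 - \<omega>(p). If both weights were positive,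
  purity would identify \<omega> with the compression by \<open>p\<close>, whose value at
  \<open>p\<close> is 1.\<close>

lemma pure_state_projection:
  fixes \<omega> :: "'a::cstar_algebra \<Rightarrow> complex"
  assumes C: "sub_cstar_algebra C" "1 \<in> C" and pure: "pure_state_on C \<omega>"
    and p: "p \<in> C" "projection p" "\<And>x. x \<in> C \<Longrightarrow> p * x = x * p"
  shows "\<omega> p \<in> {0, 1}"
proof (rule ccontr)
  have st: "positive_functional_on C \<omega>" "\<omega> 1 = 1"
    using pure by (auto simp: pure_state_on_def state_on_iff[OF C])
  interpret positive_functional C \<omega> by unfold_locales (use C st in auto)
  assume n: "\<omega> p \<notin> {0, 1}"
  have q: "1 - p \<in> C" "projection (1 - p)" "\<And>x. x \<in> C \<Longrightarrow> (1 - p) * x = x * (1 - p)"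
    using p by (auto simp: B_intros projection_diff algebra_simps)
  have q1: "\<omega> (1 - p) = 1 - \<omega> p" using p st by (simp add: diff B_intros)
  define t where "t = Re (\<omega> p)"
  have "\<omega> p \<in> \<real>\<^sub>\<ge>\<^sub>0" "\<omega> (1 - p) \<in> \<real>\<^sub>\<ge>\<^sub>0"
    using pos[OF p(1)] pos[OF q(1)] p(2) q(2) by (simp_all add: projection_def)
  then have t: "\<omega> p = of_real t" "0 \<le> t" "t \<le> 1"
    by (auto simp: q1 t_def complex_nonneg_Reals_iff complex_eq_iff)
  then have t': "0 < t" "t < 1" using n by (auto simp: less_le)
  let ?a = "\<lambda>x. \<omega> (p * x) / \<omega> p" and ?b = "\<lambda>x. \<omega> ((1 - p) * x) / \<omega> (1 - p)"
  have "state_on C ?a" "state_on C ?b"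
    using state_on_compress[OF p] state_on_compress[OF q] n q1 by auto
  moreover have "\<omega> x = of_real t * ?a x + of_real (1 - t) * ?b x" if "x \<in> C" for x
    using that p t t' by (simp add: q1 left_diff_distrib diff B_intros field_simps)
  ultimately have "?a p = \<omega> p"
    using pure t' p(1) unfolding pure_state_on_def by blast
  then show False using n p(2) by (simp add: projection_def)
qed

lemma pure_state_symmetry:
  fixes \<omega> :: "'a::cstar_algebra \<Rightarrow> complex"
  assumes C: "sub_cstar_algebra C" "1 \<in> C" and pure: "pure_state_on C \<omega>"
    and u: "u \<in> C" "symmetry u" "\<And>x. x \<in> C \<Longrightarrow> u * x = x * u"
  obtains s where "s \<in> {1, -1}" "\<omega> u = of_real s"
proof -
  have st: "positive_functional_on C \<omega>" "\<omega> 1 = 1"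
    using pure by (auto simp: pure_state_on_def state_on_iff[OF C])
  interpret positive_functional C \<omega> by unfold_locales (use C st in auto)
  have "\<omega> (spectral_projection u 1) \<in> {0, 1}"
    using u by (intro pure_state_projection[OF C pure] projection_spectral)
      (auto simp: spectral_projection_def B_intros algebra_simps)
  then have "\<omega> u = 1 \<or> \<omega> u = -1"
    using u st(2) by (simp add: spectral_projection_def scaleR add B_intros)
      (metis add.commute add_diff_cancel_left' add_uminus_conv_diff diff_numeral_special(9) eq_neg_iff_add_eq_0 one_add_one)
  then show ?thesis using that[of 1] that[of "-1"] by auto
qed

section \<open>Unique extension of pure states\<close>

text \<open>Here \<open>L\<close> plays the union of the local algebras and \<open>G\<close> the
  Pauli products; the lattice enters through the dichotomy \<open>G\<close>. \<open>L_pos\<close> is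
  the only axiom about positivity, and it concerns elements of \<open>L\<close> alone.\<close>

locale unique_extension =
  fixes C L G :: "'a::cstar_algebra set"
  assumes C: "sub_cstar_algebra C" and C_one: "1 \<in> C"
    and C_comm: "\<And>x y. x \<in> C \<Longrightarrow> y \<in> C \<Longrightarrow> x * y = y * x"
    and L_one: "1 \<in> L"
    and L_add: "\<And>x y. x \<in> L \<Longrightarrow> y \<in> L \<Longrightarrow> x + y \<in> L"
    and L_mult: "\<And>x y. x \<in> L \<Longrightarrow> y \<in> L \<Longrightarrow> x * y \<in> L"
    and L_scale: "\<And>c x. x \<in> L \<Longrightarrow> c *\<^sub>C x \<in> L"
    and L_adj: "\<And>x. x \<in> L \<Longrightarrow> adj x \<in> L"
    and L_dense: "closure L = UNIV"
    and L_span: "L \<subseteq> complex_span G"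
    and G: "\<And>g. g \<in> G \<Longrightarrow> g \<in> C \<inter> L \<and> symmetry g \<or>
      (\<exists>u\<in>C \<inter> L. symmetry u \<and> u * g = - (g * u))"
    and L_pos: "\<And>p y c. p \<in> L \<Longrightarrow> y \<in> L \<Longrightarrow> projection p \<Longrightarrow> p \<noteq> 0 \<Longrightarrow> adj y * y = c *\<^sub>C p \<Longrightarrow>
      c \<in> \<real>\<^sub>\<ge>\<^sub>0"
begin

text \<open>On \<open>G\<close> two extensions agree, either because the element lies in
  \<open>C\<close> or because both vanish there; linearity and boundedness do the rest. Purity is
  asked of \<omega> only, so the statement also applies to the parts of a convex
  decomposition.\<close>

lemma state_unique:
  assumes pure: "pure_state_on C \<omega>"
    and \<phi>: "state_on UNIV \<phi>" "\<And>x. x \<in> C \<Longrightarrow> \<phi> x = \<omega> x"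
    and \<psi>: "state_on UNIV \<psi>" "\<And>x. x \<in> C \<Longrightarrow> \<psi> x = \<omega> x"
  shows "\<phi> = \<psi>"
proof -
  have iff: "state_on UNIV f \<longleftrightarrow> positive_functional_on UNIV f \<and> f 1 = 1" for f :: "'a \<Rightarrow> complex"
    by (rule state_on_iff) (simp_all add: sub_cstar_algebra_UNIV)
  interpret \<phi>: positive_functional UNIV \<phi>
    by unfold_locales (use \<phi>(1) in \<open>auto simp: iff sub_cstar_algebra_UNIV\<close>)
  interpret \<psi>: positive_functional UNIV \<psi>
    by unfold_locales (use \<psi>(1) in \<open>auto simp: iff sub_cstar_algebra_UNIV\<close>)
  have 1: "\<phi> 1 = 1" "\<psi> 1 = 1" using \<phi>(1) \<psi>(1) by (simp_all add: iff)
  have "\<phi> x = \<psi> x" if "x \<in> complex_span G" for x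
    using that
  proof induction
    case (base g)
    from G[OF base] show ?case
    proof (elim disjE bexE conjE)
      assume "g \<in> C \<inter> L"
      then show ?thesis using \<phi>(2) \<psi>(2) by simp
    next
      fix u assume u: "u \<in> C \<inter> L" "symmetry u" "u * g = - (g * u)"
      then obtain s where s: "s \<in> {1, -1}" "\<omega> u = of_real s"
        using pure_state_symmetry[OF C C_one pure, of u] C_comm by blast
      then show ?thesis
        using \<phi>.anticommute_zero[of g u s] \<psi>.anticommute_zero[of g u s] u \<phi>(2)[of u] \<psi>(2)[of u] 1
        by simp
    qed
  qed (simp_all add: \<phi>.add \<psi>.add \<phi>.scale \<psi>.scale)
  then have L: "L \<subseteq> {x. \<phi> x = \<psi> x}" using L_span by blast
  have bl: "bounded_linear f" if "positive_functional UNIV f" for f :: "'a \<Rightarrow> complex"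
  proof -
    interpret positive_functional UNIV f by fact
    show ?thesis
      by (rule bounded_linear_intro[where K = "Re (f 1)"])
        (use cmod_le in \<open>auto simp: add scaleR scaleR_conv_of_real[where 'a = complex] mult.commute\<close>)
  qed
  have "closed {x. \<phi> x = \<psi> x}"
    by (intro closed_Collect_eq linear_continuous_on bl) unfold_locales
  then have "closure L \<subseteq> {x. \<phi> x = \<psi> x}" by (rule closure_minimal[OF L])
  then show ?thesis using L_dense by auto
qed

end

text \<open>The extension of \<open>\<omega>\<close> is read off from compressions: \<open>p x p\<close> approaches \<open>\<phi>(x) p\<close> along the
  projections \<open>p\<close> of \<open>C\<close> on which \<open>\<omega>\<close> is 1.\<close>

locale extended_pure_state = unique_extension C L G
  for C L G :: "'a::cstar_algebra set" +
  fixes \<omega> :: "'a \<Rightarrow> complex"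
  assumes pure: "pure_state_on C \<omega>"
begin

lemma \<omega>: "positive_functional_on C \<omega>" "\<omega> 1 = 1"
  using pure by (auto simp: pure_state_on_def state_on_iff[OF C C_one])

sublocale \<omega>: positive_functional C \<omega>
  by unfold_locales (use C C_one \<omega> in auto)

text \<open>Membership in \<open>L\<close> keeps compressions of local elements local, as
  \<open>L_pos\<close> requires.\<close>

definition carriers :: "'a set" where
  "carriers = {p \<in> C \<inter> L. projection p \<and> \<omega> p = 1}"

lemma carriersD:
  assumes "p \<in> carriers"
  shows "p \<in> C" "p \<in> L" "projection p" "adj p = p" "p * p = p" "\<omega> p = 1" "p \<noteq> 0" "norm p = 1"
proof -
  show *: "p \<in> C" "p \<in> L" "projection p" "adj p = p" "p * p = p" "\<omega> p = 1"
    using assms by (auto simp: carriers_def projection_def)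
  show "p \<noteq> 0" using *(6) \<omega>.scale[OF C_one, of 0] by (auto simp: scaleC_zero_left)
  then show "norm p = 1" using * by (intro norm_projection)
qed

text \<open>This makes \<open>carriers\<close> directed: \<open>p * q\<close> lies below both
  factors, so two approximations can be compared at one projection.\<close>

lemma carriers_mult:
  assumes "p \<in> carriers" "q \<in> carriers"
  shows "p * q \<in> carriers"
proof -
  have "\<omega> (p * q) = 1"
    using \<omega>.projection_absorb(1)[of q p] assms by (simp add: carriersD \<omega>)
  then show ?thesis
    using assms carriersD[OF assms(1)] carriersD[OF assms(2)]
    by (auto simp: carriers_def \<omega>.B_intros L_mult intro!: projection_mult C_comm)
qed

lemma carriers_comm: "p \<in> carriers \<Longrightarrow> q \<in> carriers \<Longrightarrow> p * q = q * p"
  by (simp add: C_comm carriersD)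

lemma spectral_carriers:
  assumes "u \<in> C \<inter> L" "symmetry u"
  obtains s where "s \<in> {1, -1}" "spectral_projection u s \<in> carriers"
proof -
  obtain s where s: "s \<in> {1, -1}" "\<omega> u = of_real s"
    using pure_state_symmetry[OF C C_one pure, of u] C_comm assms by blast
  have "spectral_projection u s \<in> carriers"
    unfolding carriers_def
  proof (intro CollectI conjI IntI projection_spectral assms s)
    show "spectral_projection u s \<in> C"
      using assms by (simp add: spectral_projection_def \<omega>.B_intros)
    show "spectral_projection u s \<in> L"
      using assms by (simp add: spectral_projection_def scaleR_scaleC L_scale L_add L_one)
    show "\<omega> (spectral_projection u s) = 1"
      using s assms by (auto simp: spectral_projection_def \<omega>.scaleR \<omega>.add \<omega>.minus \<omega>.B_intros \<omega>)
  qed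
  then show ?thesis using s that by blast
qed

section \<open>Compressions and their limit values\<close>

lemma compress_mult:
  assumes "p \<in> carriers" "q \<in> carriers"
  shows "(p * q) * x * (p * q) = q * (p * x * p) * q"
  by (metis carriers_comm[OF assms] mult.assoc)

lemma norm_compress_le:
  assumes "p \<in> carriers"
  shows "norm (p * x * p) \<le> norm x"
proof -
  have "norm (p * x * p) \<le> norm p * norm x * norm p"
    by (meson norm_ge_zero mult_right_mono norm_mult_ineq order_trans)
  then show ?thesis using assms by (simp add: carriersD)
qed

text \<open>The error is explicit so that exact compressions, with \<epsilon> = 0, and their limits
  obey the same rules.\<close>

definition approx :: "real \<Rightarrow> 'a \<Rightarrow> complex \<Rightarrow> 'a \<Rightarrow> bool" where
  "approx \<epsilon> x c p \<longleftrightarrow> p \<in> carriers \<and> norm (p * x * p - c *\<^sub>C p) \<le> \<epsilon>"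

text \<open>Since \<open>p\<close> and \<open>q\<close> commute, passing from \<open>p\<close> to
  \<open>p * q\<close> compresses the whole error term by \<open>q\<close>, which cannot increase
  its norm.\<close>

lemma approx_refine:
  assumes "approx \<epsilon> x c p" "q \<in> carriers"
  shows "approx \<epsilon> x c (p * q)"
proof -
  have p: "p \<in> carriers" using assms by (simp add: approx_def)
  have "q * p * q = p * q"
    using carriers_comm[OF p assms(2)] carriersD[OF assms(2)] by (metis mult.assoc)
  then have "p * q * x * (p * q) - c *\<^sub>C (p * q) = q * (p * x * p - c *\<^sub>C p) * q"
    by (simp add: compress_mult[OF p assms(2)] left_diff_distrib right_diff_distrib
        mult_scaleC_left mult_scaleC_right)
  then show ?thesis
    using norm_compress_le[OF assms(2), of "p * x * p - c *\<^sub>C p"] assms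
    by (simp add: approx_def carriers_mult)
qed

lemma approx_refine':
  assumes "approx \<epsilon> x c q" "p \<in> carriers"
  shows "approx \<epsilon> x c (p * q)"
  by (metis approx_refine[OF assms] carriers_comm approx_def assms)

lemma approx_add:
  assumes "approx \<epsilon> x c p" "approx \<delta> y d q"
  shows "approx (\<epsilon> + \<delta>) (x + y) (c + d) (p * q)"
proof -
  let ?r = "p * q"
  have pq: "p \<in> carriers" "q \<in> carriers" using assms by (simp_all add: approx_def)
  have r: "approx \<epsilon> x c ?r" "approx \<delta> y d ?r"
    using approx_refine[OF assms(1) pq(2)] approx_refine'[OF assms(2) pq(1)] .
  have "?r * (x + y) * ?r - (c + d) *\<^sub>C ?r = (?r * x * ?r - c *\<^sub>C ?r) + (?r * y * ?r - d *\<^sub>C ?r)"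
    by (simp add: distrib_left distrib_right scaleC_add_left)
  also have "norm \<dots> \<le> \<epsilon> + \<delta>"
    using r by (intro norm_triangle_mono) (simp_all add: approx_def)
  finally show ?thesis using r by (simp add: approx_def)
qed

lemma approx_scale:
  assumes "approx \<epsilon> x c p"
  shows "approx (cmod d * \<epsilon>) (d *\<^sub>C x) (d * c) p"
proof -
  have "p * (d *\<^sub>C x) * p - (d * c) *\<^sub>C p = d *\<^sub>C (p * x * p - c *\<^sub>C p)"
    by (simp add: mult_scaleC_left mult_scaleC_right scaleC_diff_right scaleC_scaleC)
  then show ?thesis using assms by (simp add: approx_def norm_scaleC mult_left_mono)
qed

lemma approx_perturb:
  assumes "approx \<epsilon> x c p"
  shows "approx (\<epsilon> + norm (y - x) + cmod (d - c)) y d p"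
proof -
  have p: "p \<in> carriers" using assms by (simp add: approx_def)
  have "p * y * p - d *\<^sub>C p = (p * x * p - c *\<^sub>C p) + p * (y - x) * p - (d - c) *\<^sub>C p"
    by (simp add: left_diff_distrib right_diff_distrib scaleC_diff_left)
  also have "norm \<dots> \<le> norm (p * x * p - c *\<^sub>C p) + norm (p * (y - x) * p) + norm ((d - c) *\<^sub>C p)"
    by (meson norm_triangle_ineq norm_triangle_ineq4 order_trans add_right_mono)
  also have "\<dots> \<le> \<epsilon> + norm (y - x) + cmod (d - c)"
    using assms norm_compress_le[OF p, of "y - x"] carriersD(8)[OF p]
    by (intro add_mono) (simp_all add: approx_def norm_scaleC)
  finally show ?thesis using p by (simp add: approx_def)
qed

lemma approx_bound:
  assumes "approx \<epsilon> x c p"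
  shows "cmod c \<le> norm x + \<epsilon>"
proof -
  have p: "p \<in> carriers" using assms by (simp add: approx_def)
  have "cmod c = norm (c *\<^sub>C p)" using carriersD(8)[OF p] by (simp add: norm_scaleC)
  also have "c *\<^sub>C p = p * x * p - (p * x * p - c *\<^sub>C p)" by simp
  also have "norm \<dots> \<le> norm (p * x * p) + norm (p * x * p - c *\<^sub>C p)" by (rule norm_triangle_ineq4)
  also have "\<dots> \<le> norm x + \<epsilon>"
    using assms norm_compress_le[OF p, of x] by (intro add_mono) (simp_all add: approx_def)
  finally show ?thesis .
qed

text \<open>Kept as a relation until each element is known to have exactly one such number;
  \<open>extension\<close> then selects it.\<close>

definition limit_value :: "'a \<Rightarrow> complex \<Rightarrow> bool" where
  "limit_value x c \<longleftrightarrow> (\<forall>\<epsilon>>0. \<exists>p. approx \<epsilon> x c p)"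

lemma limit_valueE:
  assumes "limit_value x c" "\<epsilon> > 0"
  obtains p where "approx \<epsilon> x c p"
  using assms unfolding limit_value_def by blast

lemma limit_value_add:
  assumes "limit_value x c" "limit_value y d"
  shows "limit_value (x + y) (c + d)"
  unfolding limit_value_def
proof (intro allI impI)
  fix \<epsilon> :: real assume "\<epsilon> > 0"
  then obtain p q where "approx (\<epsilon> / 2) x c p" "approx (\<epsilon> / 2) y d q"
    using assms unfolding limit_value_def by (meson half_gt_zero)
  from approx_add[OF this] show "\<exists>p. approx \<epsilon> (x + y) (c + d) p" by auto
qed

lemma limit_value_scale:
  assumes "limit_value x c"
  shows "limit_value (d *\<^sub>C x) (d * c)"
  unfolding limit_value_def
proof (intro allI impI)
  fix \<epsilon> :: real assume e: "\<epsilon> > 0"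
  then have "0 < \<epsilon> / (cmod d + 1)" by (simp add: add_nonneg_pos)
  then obtain p where p: "approx (\<epsilon> / (cmod d + 1)) x c p"
    using assms unfolding limit_value_def by blast
  have "cmod d * (\<epsilon> / (cmod d + 1)) \<le> \<epsilon>"
    using e by (simp add: pos_divide_le_eq add_nonneg_pos distrib_left mult.commute)
  then show "\<exists>p. approx \<epsilon> (d *\<^sub>C x) (d * c) p"
    using approx_scale[OF p, of d] by (meson approx_def order_trans)
qed

text \<open>This estimate yields uniqueness, applied to the difference x - x, and also the
  convergence of values along a convergent sequence.\<close>

lemma limit_value_bound:
  assumes "limit_value x c"
  shows "cmod c \<le> norm x"
proof (rule field_le_epsilon)
  show "cmod c \<le> norm x + \<epsilon>" if "\<epsilon> > 0" for \<epsilon> :: real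
    using assms approx_bound that unfolding limit_value_def by blast
qed

lemma limit_value_diff:
  assumes "limit_value x c" "limit_value y d"
  shows "limit_value (x - y) (c - d)"
  using limit_value_add[OF assms(1) limit_value_scale[OF assms(2), of "-1"]]
  by (simp add: scaleC_minus_one)

lemma limit_value_unique:
  assumes "limit_value x c" "limit_value x d"
  shows "c = d"
  using limit_value_bound[OF limit_value_diff[OF assms]] by simp

lemma limit_value_exact:
  assumes "p \<in> carriers" "p * x * p = c *\<^sub>C p"
  shows "limit_value x c"
  using assms by (auto simp: limit_value_def approx_def intro!: exI[of _ p])

lemma exact_value_span:
  assumes "x \<in> complex_span G"
  shows "\<exists>c. \<exists>p\<in>carriers. p * x * p = c *\<^sub>C p"
  using assms
proof induction
  case (base g)
  from G[OF base] show ?case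
  proof (elim disjE bexE conjE)
    assume g: "g \<in> C \<inter> L" "symmetry g"
    then obtain s where s: "s \<in> {1, -1}" "spectral_projection g s \<in> carriers"
      by (rule spectral_carriers)
    then have "spectral_projection g s * g * spectral_projection g s =
        of_real s *\<^sub>C spectral_projection g s"
      using carriersD(5)[OF s(2)]
      by (simp add: symmetry_mult_spectral[OF g(2) s(1)] scaleR_scaleC[symmetric])
    then show ?thesis using s by blast
  next
    fix u assume u: "u \<in> C \<inter> L" "symmetry u" "u * g = - (g * u)"
    then obtain s where s: "s \<in> {1, -1}" "spectral_projection u s \<in> carriers"
      using spectral_carriers by blast
    let ?p = "spectral_projection u s"
    \<comment> \<open>The projection turns \<open>u\<close> into \<open>s\<close> on either side of
      \<open>g\<close>; moving \<open>u\<close> across \<open>g\<close> costs a sign, so the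
      compression equals its own negative.\<close>
    have "s *\<^sub>R (?p * g * ?p) = (?p * u) * g * ?p"
      by (simp add: symmetry_mult_spectral[OF u(2) s(1)])
    also have "\<dots> = - (?p * g * (u * ?p))" using u(3) by (simp add: mult.assoc)
    also have "\<dots> = - (s *\<^sub>R (?p * g * ?p))"
      by (simp add: symmetry_mult_spectral[OF u(2) s(1)])
    finally have "?p * g * ?p = - (?p * g * ?p)" using s(1) by auto
    then have "2 *\<^sub>R (?p * g * ?p) = 0" unfolding scaleR_2 by (metis ab_left_minus)
    then have "?p * g * ?p = 0 *\<^sub>C ?p" by (simp add: scaleC_zero_left)
    then show ?thesis using s by blast
  qed
next
  case (add x y)
  then obtain c p d q where p: "p \<in> carriers" "p * x * p = c *\<^sub>C p"
    and q: "q \<in> carriers" "q * y * q = d *\<^sub>C q" by blast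
  \<comment> \<open>Zero error turns the approximate rule for sums into an exact one at the common
    carrier.\<close>
  have "approx (0 + 0) (x + y) (c + d) (p * q)"
    by (rule approx_add) (use p q in \<open>simp_all add: approx_def\<close>)
  then show ?case by (auto simp: approx_def)
next
  case (scale x d)
  then obtain c p where p: "p \<in> carriers" "p * x * p = c *\<^sub>C p" by blast
  have "approx (cmod d * 0) (d *\<^sub>C x) (d * c) p"
    by (rule approx_scale) (use p in \<open>simp_all add: approx_def\<close>)
  then show ?case by (auto simp: approx_def)
qed

text \<open>The values of local approximants form a Cauchy sequence because limit values are
  contractive. The three thirds of \<epsilon> pay for the compression, the element and the
  value.\<close>

lemma limit_value_exists: "\<exists>c. limit_value x c"
proof -
  have "x \<in> closure L" using L_dense by simp
  then obtain X where X: "\<And>n. X n \<in> L" "X \<longlonglongrightarrow> x"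
    unfolding closure_sequential by blast
  have "\<exists>c. limit_value (X n) c" for n
    using exact_value_span[of "X n"] X(1) L_span limit_value_exact by blast
  then obtain c where c: "\<And>n. limit_value (X n) (c n)" by metis
  have "Cauchy c"
  proof (rule metric_CauchyI)
    fix e :: real assume "e > 0"
    then obtain M where "\<forall>m\<ge>M. \<forall>n\<ge>M. dist (X m) (X n) < e"
      using LIMSEQ_imp_Cauchy[OF X(2)] metric_CauchyD by blast
    then show "\<exists>M. \<forall>m\<ge>M. \<forall>n\<ge>M. dist (c m) (c n) < e"
      using limit_value_bound[OF limit_value_diff[OF c c]] by (metis dist_norm le_less_trans)
  qed
  then obtain d where d: "c \<longlonglongrightarrow> d" using Cauchy_convergent convergent_def by blast
  have "limit_value x d"
    unfolding limit_value_def
  proof (intro allI impI)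
    fix \<epsilon> :: real assume e: "\<epsilon> > 0"
    then have "0 < \<epsilon> / 3" by simp
    from tendstoD[OF X(2) this] tendstoD[OF d this]
    have "eventually (\<lambda>n. dist (X n) x < \<epsilon> / 3 \<and> dist (c n) d < \<epsilon> / 3) sequentially"
      by (rule eventually_conj)
    then obtain n where n: "dist (X n) x < \<epsilon> / 3" "dist (c n) d < \<epsilon> / 3"
      using eventually_happens'[OF sequentially_bot] by blast
    obtain p where "approx (\<epsilon> / 3) (X n) (c n) p"
      using limit_valueE[OF c \<open>0 < \<epsilon> / 3\<close>] by blast
    from approx_perturb[OF this, of x d]
    have "approx (\<epsilon> / 3 + norm (x - X n) + cmod (d - c n)) x d p" .
    moreover have "\<epsilon> / 3 + norm (x - X n) + cmod (d - c n) \<le> \<epsilon>"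
      using n by (simp add: dist_norm norm_minus_commute)
    ultimately show "\<exists>p. approx \<epsilon> x d p" by (meson approx_def order_trans)
  qed
  then show ?thesis by blast
qed

section \<open>The extended state\<close>

definition extension :: "'a \<Rightarrow> complex" where
  "extension x = (THE c. limit_value x c)"

lemma limit_value_extension: "limit_value x (extension x)"
  unfolding extension_def
  by (rule theI') (use limit_value_exists limit_value_unique in blast)

lemma extension_eqI: "limit_value x c \<Longrightarrow> extension x = c"
  by (rule limit_value_unique[OF limit_value_extension])

lemma extension_add: "extension (x + y) = extension x + extension y"
  by (intro extension_eqI limit_value_add limit_value_extension)

lemma extension_scale: "extension (c *\<^sub>C x) = c * extension x"
  by (intro extension_eqI limit_value_scale limit_value_extension)

lemma cmod_extension_le: "cmod (extension x) \<le> norm x"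
  by (rule limit_value_bound[OF limit_value_extension])

lemma bounded_linear_extension: "bounded_linear extension"
proof (rule bounded_linear_intro[where K = 1])
  show "extension (r *\<^sub>R x) = r *\<^sub>R extension x" for r x
    by (simp only: scaleR_scaleC extension_scale scaleR_conv_of_real)
qed (use cmod_extension_le in \<open>simp_all add: extension_add\<close>)

text \<open>A state absorbs projections of value 1, so \<omega>(p x p) = \<omega>(x), while p x p is
  within \<epsilon> of the extended value times \<open>p\<close>.\<close>

lemma extension_eq: "extension x = \<omega> x" if x: "x \<in> C"
proof -
  have "cmod (\<omega> x - extension x) \<le> \<epsilon>" if e: "\<epsilon> > 0" for \<epsilon>
  proof -
    obtain p where "approx \<epsilon> x (extension x) p"
      by (rule limit_valueE[OF limit_value_extension e])
    then have p: "p \<in> carriers" "norm (p * x * p - extension x *\<^sub>C p) \<le> \<epsilon>"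
      by (simp_all add: approx_def)
    have pC: "p \<in> C" "projection p" "\<omega> p = \<omega> 1" using carriersD[OF p(1)] \<omega> by auto
    have "\<omega> (p * x * p) = \<omega> x"
      using \<omega>.projection_absorb(1)[OF x pC] \<omega>.projection_absorb(2)[OF _ pC, of "p * x"] x pC
      by (simp add: \<omega>.B_intros)
    then have "\<omega> x - extension x = \<omega> (p * x * p - extension x *\<^sub>C p)"
      using x pC \<omega> by (simp add: \<omega>.diff \<omega>.scale \<omega>.B_intros)
    also have "cmod \<dots> \<le> norm (p * x * p - extension x *\<^sub>C p)"
      using \<omega>.cmod_le[of "p * x * p - extension x *\<^sub>C p"] x pC \<omega> by (simp add: \<omega>.B_intros)
    finally show ?thesis using p(2) by simp
  qed
  from field_le_epsilon[of "cmod (\<omega> x - extension x)" 0] this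
  have "cmod (\<omega> x - extension x) \<le> 0" by auto
  then show ?thesis by simp
qed

text \<open>For local \<open>y\<close> the exact compression of y* y at \<open>p\<close> is the
  square of y p, so \<open>L_pos\<close> gives the sign. Limits follow because the nonnegative reals
  are closed.\<close>

lemma extension_pos: "extension (adj x * x) \<in> \<real>\<^sub>\<ge>\<^sub>0"
proof -
  have L: "L \<subseteq> {y. extension (adj y * y) \<in> \<real>\<^sub>\<ge>\<^sub>0}"
  proof clarify
    fix y assume y: "y \<in> L"
    then have "adj y * y \<in> complex_span G" using L_span L_adj L_mult by blast
    then obtain c p where p: "p \<in> carriers" "p * (adj y * y) * p = c *\<^sub>C p"
      using exact_value_span by blast
    then have "adj (y * p) * (y * p) = c *\<^sub>C p"
      by (simp add: adj_mult carriersD(4) mult.assoc)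
    then have "c \<in> \<real>\<^sub>\<ge>\<^sub>0"
      using carriersD[OF p(1)] y by (intro L_pos[of p "y * p"]) (simp_all add: L_mult)
    then show "extension (adj y * y) \<in> \<real>\<^sub>\<ge>\<^sub>0"
      using extension_eqI[OF limit_value_exact[OF p]] by simp
  qed
  have "continuous_on UNIV (\<lambda>y. extension (adj y * y))"
    by (intro bounded_linear.continuous_on[OF bounded_linear_extension] continuous_intros)
  then have "closed ((\<lambda>y. extension (adj y * y)) -` \<real>\<^sub>\<ge>\<^sub>0)"
    by (intro closed_vimage closed_nonneg_Reals_complex)
  then have "closure L \<subseteq> (\<lambda>y. extension (adj y * y)) -` \<real>\<^sub>\<ge>\<^sub>0"
    using L by (intro closure_minimal) auto
  then show ?thesis using L_dense by auto
qed

lemma state_extension: "state_on UNIV extension"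
proof -
  have "positive_functional_on UNIV extension"
    unfolding positive_functional_on_def
    by (auto simp: extension_add extension_scale extension_pos
        intro!: bdd_aboveI2[where M = 1] order_trans[OF cmod_extension_le])
  moreover have "extension 1 = 1" using extension_eq[OF C_one] \<omega> by simp
  ultimately show ?thesis by (simp add: state_on_iff sub_cstar_algebra_UNIV)
qed

lemma state_on_restrict:
  assumes "state_on UNIV f"
  shows "state_on C f"
proof -
  have "positive_functional_on UNIV f" "f 1 = 1"
    using assms by (simp_all add: state_on_iff sub_cstar_algebra_UNIV)
  moreover have "positive_functional_on C f" if "positive_functional_on UNIV f"
    using that unfolding positive_functional_on_def by (auto elim!: bdd_above_mono)
  ultimately show ?thesis by (simp add: state_on_iff[OF C C_one])
qed

lemma pure_state_extension: "pure_state_on UNIV extension"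
  unfolding pure_state_on_def
proof (intro conjI allI impI state_extension)
  fix \<psi>\<^sub>1 \<psi>\<^sub>2 :: "'a \<Rightarrow> complex" and t :: real
  assume *: "state_on UNIV \<psi>\<^sub>1 \<and> state_on UNIV \<psi>\<^sub>2 \<and> 0 < t \<and> t < 1 \<and>
    (\<forall>x\<in>UNIV. extension x = of_real t * \<psi>\<^sub>1 x + of_real (1 - t) * \<psi>\<^sub>2 x)"
  then have "state_on C \<psi>\<^sub>1" "state_on C \<psi>\<^sub>2"
    "\<forall>x\<in>C. \<omega> x = of_real t * \<psi>\<^sub>1 x + of_real (1 - t) * \<psi>\<^sub>2 x"
    by (auto simp: state_on_restrict extension_eq[symmetric])
  then have "\<forall>x\<in>C. \<psi>\<^sub>1 x = \<omega> x \<and> \<psi>\<^sub>2 x = \<omega> x"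
    using pure * unfolding pure_state_on_def by blast
  then have "\<psi>\<^sub>1 = extension" "\<psi>\<^sub>2 = extension"
    using * state_unique[OF pure _ _ state_extension extension_eq] by blast+
  then show "\<forall>x\<in>UNIV. \<psi>\<^sub>1 x = extension x \<and> \<psi>\<^sub>2 x = extension x" by simp
qed

lemma unique_pure_extension: "\<exists>!\<phi>. pure_state_on UNIV \<phi> \<and> (\<forall>x\<in>C. \<phi> x = \<omega> x)"
proof (rule ex1I)
  show "pure_state_on UNIV extension \<and> (\<forall>x\<in>C. extension x = \<omega> x)"
    using pure_state_extension extension_eq by blast
  show "\<phi> = extension" if "pure_state_on UNIV \<phi> \<and> (\<forall>x\<in>C. \<phi> x = \<omega> x)" for \<phi>
    using that state_unique[OF pure _ _ state_extension extension_eq]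
    unfolding pure_state_on_def by blast
qed

end

section \<open>Cycles and boundaries in the square lattice\<close>

text \<open>\<open>(True, x, y)\<close> encodes the edge from \<open>(x, y)\<close> to \<open>(x + 1, y)\<close> and \<open>(False, x, y)\<close>
  the edge from \<open>(x, y)\<close> to \<open>(x, y + 1)\<close>.\<close>

type_synonym edge_index = "bool \<times> int \<times> int"

definition star_set :: "int \<Rightarrow> int \<Rightarrow> edge_index set" where
  "star_set x y = {(True, x, y), (False, x, y), (True, x - 1, y), (False, x, y - 1)}"

definition face_set :: "int \<Rightarrow> int \<Rightarrow> edge_index set" where
  "face_set x y = {(True, x, y), (False, x + 1, y), (True, x, y + 1), (False, x, y)}"

text \<open>Sets stand for chains with coefficients modulo 2 and symmetric difference for their
  addition; this is the span of the \<open>F x y\<close>.\<close>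

inductive sum_of :: "(int \<Rightarrow> int \<Rightarrow> 'i set) \<Rightarrow> 'i set \<Rightarrow> bool" for F where
  sum_of_empty: "sum_of F {}"
| sum_of_step: "sum_of F T \<Longrightarrow> sum_of F (sym_diff T (F x y))"

lemma finite_star_set [simp]: "finite (star_set x y)"
  by (simp add: star_set_def)

lemma finite_face_set [simp]: "finite (face_set x y)"
  by (simp add: face_set_def)

lemma sym_diff_sym_diff_cancel: "sym_diff (sym_diff T F) F = T"
  by blast

lemma even_card_sym_diff:
  assumes "finite A" "finite B"
  shows "even (card (sym_diff A B)) \<longleftrightarrow> even (card A + card B)"
proof -
  have "card (sym_diff A B) = card (A - B) + card (B - A)"
    using assms by (intro card_Un_disjoint) auto
  moreover have "card A = card (A - B) + card (A \<inter> B)" "card B = card (B - A) + card (A \<inter> B)"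
    using assms by (metis Diff_Int_distrib Int_Diff_Un Int_commute card_Int_Diff add.commute)+
  ultimately show ?thesis by presburger
qed

lemma even_card_sym_diff_Int:
  assumes "finite A" "finite B"
  shows "even (card (sym_diff A B \<inter> K)) \<longleftrightarrow> even (card (A \<inter> K) + card (B \<inter> K))"
proof -
  have "sym_diff A B \<inter> K = sym_diff (A \<inter> K) (B \<inter> K)" by blast
  then show ?thesis using even_card_sym_diff[of "A \<inter> K" "B \<inter> K"] assms by simp
qed

text \<open>A face and a star share two edges when the vertex is a corner of the face, and none
  otherwise. This is the vanishing of the boundary of a boundary, and also why stars and faces
  commute.\<close>

lemma even_face_star: "even (card (face_set a b \<inter> star_set x y))"
proof -
  consider "a = x \<and> b = y" | "a = x \<and> b = y - 1" | "a = x - 1 \<and> b = y" | "a = x - 1 \<and> b = y - 1"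
    | "a \<noteq> x \<and> a \<noteq> x - 1 \<or> b \<noteq> y \<and> b \<noteq> y - 1"
    by blast
  then show ?thesis
    by cases (auto simp: face_set_def star_set_def Int_insert_left)
qed

lemma even_card_contradiction: "even (card (S \<inter> K)) \<Longrightarrow> S \<inter> K = {k} \<Longrightarrow> False"
  by simp

lemma finite_int_fun_max:
  fixes f :: "'i \<Rightarrow> int"
  assumes "finite T" "T \<noteq> {}"
  obtains t where "t \<in> T" "\<And>s. s \<in> T \<Longrightarrow> f s \<le> f t"
proof -
  have "Max (f ` T) \<in> f ` T" using assms by (intro Max_in) auto
  then obtain t where "t \<in> T" "f t = Max (f ` T)" by auto
  then show ?thesis using assms that[of t] by simp
qed

text \<open>Adding the face below a horizontal edge pushes that edge down one row, so a cycle in the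
  upper half plane \<open>y \<ge> -N\<close> can be swept into the bottom row.\<close>

lemma cycle_is_boundary:
  assumes "finite T" and "\<And>x y. even (card (T \<inter> star_set x y))"
  shows "sum_of face_set T"
proof -
  \<comment> \<open>As \<open>T\<close> is finite, the sum of all heights in absolute value is a
    crude but sufficient depth.\<close>
  obtain N :: int where N: "\<And>b x y. (b, x, y) \<in> T \<Longrightarrow> - N \<le> y"
  proof
    show "- (\<Sum>t\<in>T. \<bar>snd (snd t)\<bar>) \<le> y" if "(b, x, y) \<in> T" for b x y
      using member_le_sum[OF that, of "\<lambda>t. \<bar>snd (snd t)\<bar>"] assms(1) by simp
  qed
  \<comment> \<open>Total height of the horizontal edges above the bottom row; vertical edges weigh
    0, so sweeping may create them freely.\<close>
  define \<mu> where "\<mu> U = (\<Sum>(b, x, y)\<in>U. if b then nat (y + N) else 0)" for U :: "edge_index set"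
  show ?thesis using assms N
  proof (induction "\<mu> T" arbitrary: T rule: less_induct)
    case less
    show ?case
    proof (cases "\<exists>x y. (True, x, y) \<in> T \<and> y > - N")
      case True
      then obtain x y where xy: "(True, x, y) \<in> T" "y > - N" by blast
      let ?F = "face_set x (y - 1)"
      let ?T = "sym_diff T ?F"
      let ?f = "\<lambda>(b, x, y). if b then nat (y + N) else 0"
      \<comment> \<open>The lower edge of the face may already lie in \<open>T\<close> and then
        cancels, so only an upper bound holds.\<close>
      have "\<mu> ?T \<le> sum ?f (insert (True, x, y - 1) (T - {(True, x, y)}))"
      proof -
        have "\<mu> ?T = sum ?f (?T \<inter> {s. fst s})"
          unfolding \<mu>_def using less.prems(1)
          by (intro sum.mono_neutral_right) (auto split: if_splits)
        also have "\<dots> \<le> sum ?f (insert (True, x, y - 1) (T - {(True, x, y)}))"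
          using less.prems(1) xy(1) by (intro sum_mono2) (auto simp: face_set_def)
        finally show ?thesis .
      qed
      also have "\<dots> \<le> nat (y - 1 + N) + sum ?f (T - {(True, x, y)})"
        using less.prems(1) by (simp add: sum.insert_if)
      also have "\<dots> < nat (y + N) + sum ?f (T - {(True, x, y)})"
        using xy(2) by simp
      also have "\<dots> = \<mu> T"
        unfolding \<mu>_def using sum.remove[OF less.prems(1) xy(1), of ?f] by simp
      finally have "\<mu> ?T < \<mu> T" .
      moreover have "finite ?T" using less.prems(1) by simp
      moreover have "even (card (?T \<inter> star_set a b))" for a b
        using less.prems(1,2) even_face_star by (simp add: even_card_sym_diff_Int)
      moreover have "- N \<le> b" if "(h, a, b) \<in> ?T" for h a b
        using that less.prems(3)[of h a b] xy(2) by (auto simp: face_set_def)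
      ultimately have "sum_of face_set ?T" by (rule less.hyps)
      from sum_of_step[OF this, of x "y - 1"] show ?thesis
        by (simp add: sym_diff_sym_diff_cancel)
    next
      case False
      then have hor: "y = - N" if "(True, x, y) \<in> T" for x y
        using that less.prems(3)[of True x y] by force
      have "T = {}"
      proof (rule ccontr)
        assume "T \<noteq> {}"
        show False
        proof (cases "T \<inter> {s. \<not> fst s} = {}")
          case False
          \<comment> \<open>Nothing else meets the upper end of a highest vertical edge: a further
            vertical edge there would be higher, and the horizontal edges are confined to the row
            -N, which is lower.\<close>
          then obtain t where t: "t \<in> T \<inter> {s. \<not> fst s}"
            "\<And>s. s \<in> T \<inter> {s. \<not> fst s} \<Longrightarrow> snd (snd s) \<le> snd (snd t)"
            using finite_int_fun_max[of "T \<inter> {s. \<not> fst s}" "\<lambda>s. snd (snd s)"] less.prems(1) by blast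
          obtain x y where xy: "t = (False, x, y)" using t(1) by (cases t) auto
          have "(False, x, y + 1) \<notin> T" using t(2)[of "(False, x, y + 1)"] xy by auto
          moreover have "(True, a, y + 1) \<notin> T" for a
            using hor[of a "y + 1"] less.prems(3)[of False x y] t(1) xy by auto
          ultimately have "T \<inter> star_set x (y + 1) = {(False, x, y)}"
            using t(1) xy by (auto simp: star_set_def)
          then show False by (rule even_card_contradiction[OF less.prems(2)])
        next
          case True
          \<comment> \<open>With only horizontal edges left, the star at the right end of a
            rightmost one meets \<open>T\<close> in that edge alone.\<close>
          obtain t where t: "t \<in> T" "\<And>s. s \<in> T \<Longrightarrow> fst (snd s) \<le> fst (snd t)"
            using finite_int_fun_max[OF less.prems(1) \<open>T \<noteq> {}\<close>, of "\<lambda>s. fst (snd s)"] by blast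
          obtain x y where xy: "t = (True, x, y)" using t(1) True by (cases t) auto
          have "(True, x + 1, y) \<notin> T" using t(2)[of "(True, x + 1, y)"] xy by auto
          then have "T \<inter> star_set (x + 1) y = {(True, x, y)}"
            using t(1) xy True by (auto simp: star_set_def)
          then show False by (rule even_card_contradiction[OF less.prems(2)])
        qed
      qed
      then show ?thesis by (simp add: sum_of_empty)
    qed
  qed
qed

text \<open>Each edge goes to the edge of the dual lattice that crosses it, translated by (1/2, 1/2)
  back onto the original lattice. Applied twice it is the translation by (1, 1).\<close>

definition dual :: "edge_index \<Rightarrow> edge_index" where
  "dual = (\<lambda>(b, x, y). if b then (False, x + 1, y) else (True, x, y + 1))"

lemma inj_dual: "inj dual"
  by (auto simp: inj_def dual_def split: if_splits)

lemma dual_star_set: "dual ` star_set x y = face_set x y"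
  by (auto simp: dual_def star_set_def face_set_def)

lemma dual_face_set: "dual ` face_set x y = star_set (x + 1) (y + 1)"
  by (auto simp: dual_def star_set_def face_set_def)

text \<open>A derivation pulls back along the injection, because the symmetric difference of two
  images is again an image.\<close>

lemma sum_of_image:
  assumes "inj g" "sum_of F (g ` T)" "\<And>x y. F x y = g ` G x y"
  shows "sum_of G T"
  using assms(2)
proof (induction "g ` T" arbitrary: T rule: sum_of.induct)
  case sum_of_empty
  then show ?case by (simp add: sum_of.sum_of_empty)
next
  case (sum_of_step U x y)
  have "U = sym_diff (g ` T) (F x y)"
    using sum_of_step.hyps(3) sym_diff_sym_diff_cancel[of U "F x y"] by simp
  also have "\<dots> = g ` sym_diff T (G x y)"
    using assms(1) by (simp add: assms(3) image_Un image_set_diff)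
  finally have "sum_of G (sym_diff T (G x y))" by (rule sum_of_step.hyps(2))
  from sum_of.sum_of_step[OF this, of x y] show ?case
    by (simp add: sym_diff_sym_diff_cancel)
qed

lemma cocycle_is_coboundary:
  assumes "finite T" and "\<And>x y. even (card (T \<inter> face_set x y))"
  shows "sum_of star_set T"
proof (rule sum_of_image[OF inj_dual _ dual_star_set[symmetric]], rule cycle_is_boundary)
  show "finite (dual ` T)" using assms(1) by simp
  show "even (card (dual ` T \<inter> star_set x y))" for x y
  proof -
    \<comment> \<open>\<open>dual\<close> sends the face at (x - 1, y - 1) to the star at (x, y),
      hence the shift.\<close>
    have "dual ` T \<inter> star_set x y = dual ` (T \<inter> face_set (x - 1) (y - 1))"
      using dual_face_set[of "x - 1" "y - 1"] by (simp add: image_Int[OF inj_dual])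
    then show ?thesis using assms(2) by (simp add: card_image inj_on_subset[OF inj_dual])
  qed
qed

section \<open>Pauli products\<close>

text \<open>The fold is unspecified unless the factors commute.\<close>

definition commuting_prod :: "('i \<Rightarrow> 'a::monoid_mult) \<Rightarrow> 'i set \<Rightarrow> 'a" where
  "commuting_prod f S = Finite_Set.fold (\<lambda>i a. f i * a) 1 S"

locale commuting_symmetries =
  fixes f :: "'i \<Rightarrow> 'a::cstar_algebra"
  assumes symmetry: "symmetry (f i)"
    and commute: "f i * f j = f j * f i"
begin

lemma square_cancel: "f i * (f i * a) = a"
  using symmetry[of i] by (simp add: symmetry_def mult.assoc[symmetric])

interpretation comp_fun_commute "\<lambda>i a. f i * a"
  by unfold_locales (use commute in \<open>auto simp: fun_eq_iff mult.assoc[symmetric]\<close>)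

lemma commuting_prod_empty: "commuting_prod f {} = 1"
  by (simp add: commuting_prod_def)

lemma commuting_prod_insert:
  "finite S \<Longrightarrow> i \<notin> S \<Longrightarrow> commuting_prod f (insert i S) = f i * commuting_prod f S"
  by (simp add: commuting_prod_def)

lemma commuting_prod_singleton: "commuting_prod f {i} = f i"
  by (simp add: commuting_prod_insert commuting_prod_empty)

lemma commuting_prod_toggle:
  assumes "finite S"
  shows "f i * commuting_prod f S = commuting_prod f (sym_diff S {i})"
proof (cases "i \<in> S")
  case True
  then have "commuting_prod f S = f i * commuting_prod f (S - {i})"
    using commuting_prod_insert[of "S - {i}" i] assms by (simp add: insert_absorb)
  then show ?thesis using True by (simp add: square_cancel)
next
  case False
  then show ?thesis using commuting_prod_insert[OF assms False] by simp
qed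

lemma commuting_prod_mult:
  assumes "finite S" "finite T"
  shows "commuting_prod f S * commuting_prod f T = commuting_prod f (sym_diff S T)"
  using assms(1)
proof induction
  case (insert i S)
  have "sym_diff (sym_diff S T) {i} = sym_diff (insert i S) T" using insert.hyps by blast
  then show ?case
    using insert assms(2) commuting_prod_toggle[of "sym_diff S T" i]
    by (simp add: commuting_prod_insert mult.assoc)
qed (simp add: commuting_prod_empty)

lemma commuting_prod_commute:
  "finite S \<Longrightarrow> finite T \<Longrightarrow> commuting_prod f S * commuting_prod f T = commuting_prod f T * commuting_prod f S"
  by (simp add: commuting_prod_mult Un_commute)

lemma symmetry_commuting_prod:
  assumes "finite S"
  shows "symmetry (commuting_prod f S)"
proof -
  have "adj (commuting_prod f S) = commuting_prod f S"
    using assms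
  proof induction
    case (insert i S)
    then show ?case
      using commuting_prod_commute[of "{i}" S] symmetry[of i]
      by (simp add: commuting_prod_insert commuting_prod_singleton adj_mult symmetry_def)
  qed (simp add: commuting_prod_empty adj_one)
  then show ?thesis
    using commuting_prod_mult[OF assms assms] by (simp add: symmetry_def commuting_prod_empty)
qed

lemma commuting_prod_twist:
  assumes "\<And>i. y * f i = \<epsilon> i *\<^sub>R (f i * y)" "finite S"
  shows "y * commuting_prod f S = (\<Prod>i\<in>S. \<epsilon> i) *\<^sub>R (commuting_prod f S * y)"
  using assms(2)
proof induction
  case (insert i S)
  have "y * (f i * commuting_prod f S) = (y * f i) * commuting_prod f S" by (simp add: mult.assoc)
  also have "\<dots> = \<epsilon> i *\<^sub>R (f i * (y * commuting_prod f S))" by (simp add: assms(1) mult.assoc)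
  finally show ?case using insert by (simp add: commuting_prod_insert mult.assoc)
qed (simp add: commuting_prod_empty)

lemma commuting_prod_closed:
  assumes "finite S" "1 \<in> L" "\<And>x y. x \<in> L \<Longrightarrow> y \<in> L \<Longrightarrow> x * y \<in> L" "\<And>i. f i \<in> L"
  shows "commuting_prod f S \<in> L"
  using assms(1) by induction (auto simp: assms commuting_prod_empty commuting_prod_insert)

text \<open>\<open>commuting_prod\<close> turns symmetric difference into multiplication, so a sum
  of generators modulo 2 becomes a product of their operators.\<close>

lemma commuting_prod_sum_of:
  assumes "sum_of F T" "\<And>x y. finite (F x y)" "1 \<in> L" "\<And>x y. x \<in> L \<Longrightarrow> y \<in> L \<Longrightarrow> x * y \<in> L"
    "\<And>x y. commuting_prod f (F x y) \<in> L"
  shows "commuting_prod f T \<in> L"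
proof -
  from assms(1) have "finite T \<and> commuting_prod f T \<in> L"
  proof induction
    case (sum_of_step T x y)
    then show ?case using assms commuting_prod_mult[of T "F x y"] by (metis finite_Diff finite_Un)
  qed (simp add: commuting_prod_empty assms)
  then show ?thesis ..
qed

end

section \<open>Pauli monomials and the star-face algebra\<close>

locale pauli_family =
  X: commuting_symmetries X + Z: commuting_symmetries Z
  for X Z :: "edge_index \<Rightarrow> 'a::cstar_algebra" +
  assumes XZ_commute: "i \<noteq> j \<Longrightarrow> X i * Z j = Z j * X i"
    and XZ_anticommute: "X i * Z i = - (Z i * X i)"
begin

abbreviation X_prod :: "edge_index set \<Rightarrow> 'a" where
  "X_prod \<equiv> commuting_prod X"

abbreviation Z_prod :: "edge_index set \<Rightarrow> 'a" where
  "Z_prod \<equiv> commuting_prod Z"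

text \<open>Each common index contributes one sign, so the parity of the overlap decides whether the
  products commute or anticommute.\<close>

lemma Z_prod_X_prod:
  assumes S: "finite S" and T: "finite T"
  shows "Z_prod T * X_prod S = (-1) ^ card (S \<inter> T) *\<^sub>R (X_prod S * Z_prod T)"
proof -
  define \<epsilon> :: "edge_index \<Rightarrow> real" where "\<epsilon> i = (if i \<in> T then -1 else 1)" for i
  have "X i * Z_prod T = \<epsilon> i *\<^sub>R (Z_prod T * X i)" for i
  proof -
    have "X i * Z_prod T = (\<Prod>j\<in>T. if i = j then -1 else 1) *\<^sub>R (Z_prod T * X i)"
      by (rule Z.commuting_prod_twist[OF _ T]) (use XZ_commute XZ_anticommute in auto)
    then show ?thesis using T by (simp add: \<epsilon>_def prod.delta)
  qed
  \<comment> \<open>Each sign is its own inverse, so the relation can be solved for the opposite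
    order.\<close>
  moreover have "\<epsilon> i * \<epsilon> i = 1" for i by (simp add: \<epsilon>_def)
  ultimately have "Z_prod T * X i = \<epsilon> i *\<^sub>R (X i * Z_prod T)" for i by simp
  from X.commuting_prod_twist[OF this S]
  have "Z_prod T * X_prod S = (\<Prod>i\<in>S. \<epsilon> i) *\<^sub>R (X_prod S * Z_prod T)" .
  also have "(\<Prod>i\<in>S. \<epsilon> i) = (\<Prod>i\<in>S \<inter> T. -1)"
    unfolding \<epsilon>_def by (rule prod.inter_restrict[OF S, symmetric])
  finally show ?thesis by simp
qed

definition pauli_monomials :: "'a set" where
  "pauli_monomials = {X_prod S * Z_prod T | S T. finite S \<and> finite T}"

lemma one_in_span: "1 \<in> complex_span pauli_monomials"
proof (rule complex_span.base)
  have "1 = X_prod {} * Z_prod {}" by (simp add: X.commuting_prod_empty Z.commuting_prod_empty)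
  then show "1 \<in> pauli_monomials" unfolding pauli_monomials_def by blast
qed

lemma X_mult_span: "x \<in> complex_span pauli_monomials \<Longrightarrow> X i * x \<in> complex_span pauli_monomials"
proof (induction rule: complex_span.induct)
  case (base x)
  then obtain S T where "x = X_prod S * Z_prod T" "finite S" "finite T"
    unfolding pauli_monomials_def by blast
  then have "X i * x = X_prod (sym_diff S {i}) * Z_prod T" "finite (sym_diff S {i})" "finite T"
    by (simp_all add: mult.assoc[symmetric] X.commuting_prod_toggle)
  then show ?case unfolding pauli_monomials_def by (blast intro: complex_span.base)
qed (auto simp: distrib_left mult_scaleC_right intro: complex_span.intros)

lemma Z_mult_span: "x \<in> complex_span pauli_monomials \<Longrightarrow> Z i * x \<in> complex_span pauli_monomials"
proof (induction rule: complex_span.induct)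
  case (base x)
  then obtain S T where x: "x = X_prod S * Z_prod T" "finite S" "finite T"
    unfolding pauli_monomials_def by blast
  have "Z i * X_prod S = (-1) ^ card (S \<inter> {i}) *\<^sub>R (X_prod S * Z i)"
    using Z_prod_X_prod[OF x(2), of "{i}"] by (simp add: Z.commuting_prod_singleton)
  then have "Z i * x = (-1) ^ card (S \<inter> {i}) *\<^sub>R (X_prod S * (Z i * Z_prod T))"
    by (simp add: x mult.assoc[symmetric])
  also have "\<dots> = (-1) ^ card (S \<inter> {i}) *\<^sub>R (X_prod S * Z_prod (sym_diff T {i}))"
    using x by (simp add: Z.commuting_prod_toggle)
  finally have "Z i * x = of_real ((-1) ^ card (S \<inter> {i})) *\<^sub>C (X_prod S * Z_prod (sym_diff T {i}))"
    by (simp only: scaleR_scaleC)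
  moreover have "X_prod S * Z_prod (sym_diff T {i}) \<in> pauli_monomials"
    using x(2,3) unfolding pauli_monomials_def by blast
  ultimately show ?case by (metis complex_span.base complex_span.scale)
qed (auto simp: distrib_left mult_scaleC_right intro: complex_span.intros)

definition stars_and_faces :: "'a set" where
  "stars_and_faces = {X_prod (star_set x y) | x y. True} \<union> {Z_prod (face_set x y) | x y. True}"

abbreviation star_face :: "'a set" where
  "star_face \<equiv> cstar_generated stars_and_faces"

lemma symmetry_stars_and_faces: "g \<in> stars_and_faces \<Longrightarrow> symmetry g"
  by (auto simp: stars_and_faces_def X.symmetry_commuting_prod Z.symmetry_commuting_prod)

lemma star_face_commute: "Z_prod (face_set a b) * X_prod (star_set x y) = X_prod (star_set x y) * Z_prod (face_set a b)"
  using Z_prod_X_prod[of "star_set x y" "face_set a b"] even_face_star[of a b x y]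
  by (simp add: Int_commute)

lemma star_face_commutative:
  assumes "x \<in> star_face" "y \<in> star_face"
  shows "x * y = y * x"
proof (rule generated_commutative[OF _ _ assms])
  show "adj g = g" if "g \<in> stars_and_faces" for g
    using symmetry_stars_and_faces[OF that] by (simp add: symmetry_def)
  show "g * h = h * g" if "g \<in> stars_and_faces" "h \<in> stars_and_faces" for g h
    using that unfolding stars_and_faces_def
    by (auto simp: star_face_commute X.commuting_prod_commute Z.commuting_prod_commute)
qed

lemma generators_in_star_face: "X_prod (star_set x y) \<in> star_face" "Z_prod (face_set x y) \<in> star_face"
  using generated_superset[of stars_and_faces] by (auto simp: stars_and_faces_def)

text \<open>\<open>cstar_generated\<close> does not adjoin a unit; it is found here as the square of
  a star.\<close>

lemma one_in_star_face: "1 \<in> star_face"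
  using sub_cstar_algebraD(3)[OF sub_cstar_algebra_generated generators_in_star_face(1) generators_in_star_face(1)]
    X.symmetry_commuting_prod[of "star_set 0 0"]
  by (metis finite_star_set symmetry_def)

lemma pauli_dichotomy:
  assumes "g \<in> pauli_monomials"
  shows "g \<in> star_face \<and> symmetry g \<or> (\<exists>u\<in>stars_and_faces. u * g = - (g * u))"
proof -
  obtain S T where g: "g = X_prod S * Z_prod T" and fin: "finite S" "finite T"
    using assms unfolding pauli_monomials_def by blast
  \<comment> \<open>A star always commutes with the X part of \<open>g\<close> and a face with the Z
    part, so an odd overlap with the other part means that the operator anticommutes with
    \<open>g\<close>.\<close>
  consider x y where "odd (card (T \<inter> star_set x y))" | x y where "odd (card (S \<inter> face_set x y))"
    | "\<And>x y. even (card (T \<inter> star_set x y))" "\<And>x y. even (card (S \<inter> face_set x y))"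
    by blast
  then show ?thesis
  proof cases
    case (1 x y)
    let ?u = "X_prod (star_set x y)"
    have a: "Z_prod T * ?u = - (?u * Z_prod T)"
      using Z_prod_X_prod[of "star_set x y" T] 1 fin by (simp add: Int_commute)
    have "g * ?u = X_prod S * (Z_prod T * ?u)" by (simp add: g mult.assoc)
    also have "\<dots> = - ((X_prod S * ?u) * Z_prod T)" by (simp add: a mult.assoc)
    also have "X_prod S * ?u = ?u * X_prod S" using fin by (simp add: X.commuting_prod_commute)
    finally have "?u * g = - (g * ?u)" by (simp add: g mult.assoc)
    then show ?thesis unfolding stars_and_faces_def by blast
  next
    case (2 x y)
    let ?u = "Z_prod (face_set x y)"
    have "?u * X_prod S = - (X_prod S * ?u)"
      using Z_prod_X_prod[of S "face_set x y"] 2 fin by simp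
    then have "?u * g = - (X_prod S * (?u * Z_prod T))" by (simp add: g mult.assoc[symmetric])
    also have "?u * Z_prod T = Z_prod T * ?u" using fin by (simp add: Z.commuting_prod_commute)
    finally have "?u * g = - (g * ?u)" by (simp add: g mult.assoc)
    then show ?thesis unfolding stars_and_faces_def by blast
  next
    case 3
    note mult = sub_cstar_algebraD(3)[OF sub_cstar_algebra_generated[of stars_and_faces]]
    have X: "X_prod S \<in> star_face"
      by (rule X.commuting_prod_sum_of[OF cocycle_is_coboundary[OF fin(1) 3(2)]])
        (auto simp: mult one_in_star_face generators_in_star_face)
    have Z: "Z_prod T \<in> star_face"
      by (rule Z.commuting_prod_sum_of[OF cycle_is_boundary[OF fin(2) 3(1)]])
        (auto simp: mult one_in_star_face generators_in_star_face)
    have c: "Z_prod T * X_prod S = X_prod S * Z_prod T" by (rule star_face_commutative[OF Z X])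
    have "symmetry g"
      using X.symmetry_commuting_prod[OF fin(1)] Z.symmetry_commuting_prod[OF fin(2)] c
      unfolding g symmetry_def by (metis adj_mult mult.assoc mult_1_right)
    then show ?thesis using mult[OF X Z] by (simp add: g)
  qed
qed

end

section \<open>The quasi-local algebra\<close>

lemma finite_configs: "finite \<Lambda> \<Longrightarrow> finite (configs \<Lambda>)"
  unfolding configs_def by (rule finite_PiE) auto

lemma restrict_configs: "restrict s \<Lambda> \<in> configs \<Lambda>"
  by (simp add: configs_def)

lemma config_eqI:
  assumes "s \<in> configs \<Lambda>" "t \<in> configs \<Lambda>" "\<And>e. e \<in> \<Lambda> \<Longrightarrow> s e = t e"
  shows "s = t"
  using assms unfolding configs_def by (meson PiE_ext)

text \<open>Matrix entries of a product of operators with disjoint supports. The symmetry of this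
  formula in the two factors is what gives commutation in the completion.\<close>

definition local_tensor ::
  "edge set \<Rightarrow> edge set \<Rightarrow> local_matrix \<Rightarrow> local_matrix \<Rightarrow> local_matrix" where
  "local_tensor \<Lambda> \<Lambda>' a b = (\<lambda>s t.
     if s \<in> configs (\<Lambda> \<union> \<Lambda>') \<and> t \<in> configs (\<Lambda> \<union> \<Lambda>')
     then a (restrict s \<Lambda>) (restrict t \<Lambda>) * b (restrict s \<Lambda>') (restrict t \<Lambda>') else 0)"

lemma local_tensor_swap: "local_tensor \<Lambda>' \<Lambda> b a = local_tensor \<Lambda> \<Lambda>' a b"
  by (simp add: local_tensor_def fun_eq_iff Un_commute mult.commute)

lemma local_tensor_in: "local_tensor \<Lambda> \<Lambda>' a b \<in> local_algebra (\<Lambda> \<union> \<Lambda>')"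
  by (simp add: local_tensor_def local_algebra_def)

lemma local_incl_in: "local_incl \<Lambda>' \<Lambda> a \<in> local_algebra \<Lambda>"
  by (simp add: local_incl_def local_algebra_def)

lemma local_mult_incl:
  assumes fin: "finite \<Lambda>" "finite \<Lambda>'" and disj: "\<Lambda> \<inter> \<Lambda>' = {}"
  shows "local_mult (\<Lambda> \<union> \<Lambda>') (local_incl \<Lambda> (\<Lambda> \<union> \<Lambda>') a) (local_incl \<Lambda>' (\<Lambda> \<union> \<Lambda>') b) =
    local_tensor \<Lambda> \<Lambda>' a b"
proof (intro ext)
  fix s t
  let ?\<Lambda> = "\<Lambda> \<union> \<Lambda>'"
  let ?g = "\<lambda>u. local_incl \<Lambda> ?\<Lambda> a s u * local_incl \<Lambda>' ?\<Lambda> b u t"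
  show "local_mult ?\<Lambda> (local_incl \<Lambda> ?\<Lambda> a) (local_incl \<Lambda>' ?\<Lambda> b) s t = local_tensor \<Lambda> \<Lambda>' a b s t"
  proof (cases "s \<in> configs ?\<Lambda> \<and> t \<in> configs ?\<Lambda>")
    case True
    \<comment> \<open>The only intermediate configuration that can contribute: the first factor
      leaves the values of \<open>s\<close> on \<Lambda>' unchanged, and the second those of
      \<open>t\<close> on \<Lambda>.\<close>
    define w where "w = restrict (\<lambda>e. if e \<in> \<Lambda> then t e else s e) ?\<Lambda>"
    have w: "w \<in> configs ?\<Lambda>" unfolding w_def by (rule restrict_configs)
    have "?g u = 0" if "u \<in> configs ?\<Lambda>" "u \<noteq> w" for u
    proof (rule ccontr)
      assume "?g u \<noteq> 0"
      then have "\<forall>e\<in>?\<Lambda> - \<Lambda>. s e = u e" "\<forall>e\<in>?\<Lambda> - \<Lambda>'. u e = t e"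
        by (auto simp: local_incl_def split: if_splits)
      then have "u = w"
        using disj by (intro config_eqI[OF that(1) w]) (auto simp: w_def)
      then show False using that by simp
    qed
    then have "(\<Sum>u\<in>configs ?\<Lambda>. ?g u) = (\<Sum>u\<in>{w}. ?g u)"
      using w fin by (intro sum.mono_neutral_right) (auto simp: finite_configs)
    also have "\<dots> = a (restrict s \<Lambda>) (restrict t \<Lambda>) * b (restrict s \<Lambda>') (restrict t \<Lambda>')"
    proof -
      have r: "restrict w \<Lambda> = restrict t \<Lambda>" "restrict w \<Lambda>' = restrict s \<Lambda>'"
        using disj by (auto simp: w_def restrict_def fun_eq_iff)
      have "\<forall>e\<in>?\<Lambda> - \<Lambda>. s e = w e" "\<forall>e\<in>?\<Lambda> - \<Lambda>'. w e = t e"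
        using disj by (auto simp: w_def)
      then have "local_incl \<Lambda> ?\<Lambda> a s w = a (restrict s \<Lambda>) (restrict w \<Lambda>)"
        "local_incl \<Lambda>' ?\<Lambda> b w t = b (restrict w \<Lambda>') (restrict t \<Lambda>')"
        using True w by (auto simp: local_incl_def)
      then show ?thesis by (simp add: r)
    qed
    finally show ?thesis
      using True by (simp add: local_mult_def local_tensor_def)
  next
    case False
    then show ?thesis by (auto simp: local_mult_def local_tensor_def local_incl_def)
  qed
qed

lemma local_algebra_closed:
  assumes "a \<in> local_algebra \<Lambda>" "b \<in> local_algebra \<Lambda>"
  shows "(\<lambda>s t. a s t + b s t) \<in> local_algebra \<Lambda>" "(\<lambda>s t. c * a s t) \<in> local_algebra \<Lambda>"
    "local_adj a \<in> local_algebra \<Lambda>" "local_mult \<Lambda> a b \<in> local_algebra \<Lambda>"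
proof -
  have z: "a s t = 0" "b s t = 0" if "s \<notin> configs \<Lambda> \<or> t \<notin> configs \<Lambda>" for s t
    using assms that by (auto simp: local_algebra_def)
  have "x \<in> local_algebra \<Lambda>" if "\<And>s t. s \<notin> configs \<Lambda> \<or> t \<notin> configs \<Lambda> \<Longrightarrow> x s t = 0" for x
    using that by (auto simp: local_algebra_def)
  note I = this
  show "(\<lambda>s t. a s t + b s t) \<in> local_algebra \<Lambda>" "(\<lambda>s t. c * a s t) \<in> local_algebra \<Lambda>"
    "local_adj a \<in> local_algebra \<Lambda>" "local_mult \<Lambda> a b \<in> local_algebra \<Lambda>"
    by (rule I, use z in \<open>auto simp: local_adj_def local_mult_def\<close>)+
qed

lemma local_algebra_zero: "(\<lambda>s t. 0) \<in> local_algebra \<Lambda>"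
  by (simp add: local_algebra_def)

lemma local_one_in: "local_one \<Lambda> \<in> local_algebra \<Lambda>"
  by (auto simp: local_algebra_def local_one_def)

lemma site_matrix_in: "site_matrix e m \<in> local_algebra {e}"
  by (auto simp: local_algebra_def site_matrix_def)

lemma site_matrix_mult: "local_mult {e} (site_matrix e m) (site_matrix e n) = site_matrix e (m ** n)"
proof (intro ext)
  fix s t
  have "(\<Sum>u\<in>configs {e}. m $ s e $ u e * n $ u e $ t e) = (\<Sum>k\<in>UNIV. m $ s e $ k * n $ k $ t e)"
    by (rule sum.reindex_bij_witness[where i = "\<lambda>k. restrict (\<lambda>_. k) {e}" and j = "\<lambda>u. u e"])
      (auto simp: configs_def intro!: config_eqI[of _ "{e}"] restrict_configs)
  then show "local_mult {e} (site_matrix e m) (site_matrix e n) s t = site_matrix e (m ** n) s t"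
    by (auto simp: local_mult_def site_matrix_def matrix_matrix_mult_def)
qed

lemma site_matrix_one: "site_matrix e (mat 1) = local_one {e}"
proof (intro ext)
  fix s t
  have "s e = t e \<longleftrightarrow> s = t" if "s \<in> configs {e}" "t \<in> configs {e}"
    using config_eqI[OF that] by auto
  then show "site_matrix e (mat 1) s t = local_one {e} s t"
    by (auto simp: site_matrix_def local_one_def mat_def)
qed

lemma site_matrix_adj: "local_adj (site_matrix e m) = site_matrix e (\<chi> i j. cnj (m $ j $ i))"
  by (auto simp: fun_eq_iff site_matrix_def local_adj_def)

lemma site_matrix_scale: "site_matrix e (\<chi> i j. c * m $ i $ j) = (\<lambda>s t. c * site_matrix e m s t)"
  by (auto simp: fun_eq_iff site_matrix_def)

lemma site_matrix_add: "site_matrix e (m + n) = (\<lambda>s t. site_matrix e m s t + site_matrix e n s t)"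
  by (auto simp: fun_eq_iff site_matrix_def)

section \<open>Local elements in the completion\<close>

context quasi_local_algebra
begin

lemma embed_zero:
  assumes "finite \<Lambda>" "\<Lambda> \<subseteq> lattice_edges"
  shows "\<iota> \<Lambda> (\<lambda>s t. 0) = 0"
  using embed_scale[OF assms local_algebra_zero, of 0] by (simp add: scaleC_zero_left)

lemma embed_sum:
  assumes \<Lambda>: "finite \<Lambda>" "\<Lambda> \<subseteq> lattice_edges" and K: "finite K"
    and a: "\<And>k. k \<in> K \<Longrightarrow> a k \<in> local_algebra \<Lambda>"
  shows "\<iota> \<Lambda> (\<lambda>s t. \<Sum>k\<in>K. a k s t) = (\<Sum>k\<in>K. \<iota> \<Lambda> (a k))"
proof -
  from K a have "(\<lambda>s t. \<Sum>k\<in>K. a k s t) \<in> local_algebra \<Lambda> \<and>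
    \<iota> \<Lambda> (\<lambda>s t. \<Sum>k\<in>K. a k s t) = (\<Sum>k\<in>K. \<iota> \<Lambda> (a k))"
  proof induction
    case (insert k K)
    then show ?case
      using local_algebra_closed(1)[of "a k" \<Lambda> "\<lambda>s t. \<Sum>k\<in>K. a k s t"]
        embed_add[OF \<Lambda>, of "a k" "\<lambda>s t. \<Sum>k\<in>K. a k s t"] by simp
  qed (simp add: local_algebra_zero embed_zero[OF \<Lambda>])
  then show ?thesis ..
qed

lemma embed_tensor:
  assumes \<Lambda>: "finite \<Lambda>" "\<Lambda> \<subseteq> lattice_edges" and \<Lambda>': "finite \<Lambda>'" "\<Lambda>' \<subseteq> lattice_edges"
    and disj: "\<Lambda> \<inter> \<Lambda>' = {}" and ab: "a \<in> local_algebra \<Lambda>" "b \<in> local_algebra \<Lambda>'"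
  shows "\<iota> (\<Lambda> \<union> \<Lambda>') (local_tensor \<Lambda> \<Lambda>' a b) = \<iota> \<Lambda> a * \<iota> \<Lambda>' b"
proof -
  let ?\<Lambda> = "\<Lambda> \<union> \<Lambda>'"
  have u: "finite ?\<Lambda>" "?\<Lambda> \<subseteq> lattice_edges" using \<Lambda> \<Lambda>' by auto
  have "\<iota> ?\<Lambda> (local_tensor \<Lambda> \<Lambda>' a b) = \<iota> ?\<Lambda> (local_incl \<Lambda> ?\<Lambda> a) * \<iota> ?\<Lambda> (local_incl \<Lambda>' ?\<Lambda> b)"
    unfolding local_mult_incl[OF \<Lambda>(1) \<Lambda>'(1) disj, symmetric]
    by (rule embed_mult[OF u]) (rule local_incl_in)+
  then show ?thesis using embed_incl[OF u _ ab(1)] embed_incl[OF u _ ab(2)] by simp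
qed

lemma embed_commute:
  assumes "finite \<Lambda>" "\<Lambda> \<subseteq> lattice_edges" "finite \<Lambda>'" "\<Lambda>' \<subseteq> lattice_edges"
    and "\<Lambda> \<inter> \<Lambda>' = {}" "a \<in> local_algebra \<Lambda>" "b \<in> local_algebra \<Lambda>'"
  shows "\<iota> \<Lambda> a * \<iota> \<Lambda>' b = \<iota> \<Lambda>' b * \<iota> \<Lambda> a"
proof -
  have "\<Lambda>' \<inter> \<Lambda> = {}" using assms(5) by blast
  then have "\<iota> \<Lambda>' b * \<iota> \<Lambda> a = \<iota> (\<Lambda>' \<union> \<Lambda>) (local_tensor \<Lambda>' \<Lambda> b a)"
    using embed_tensor assms by simp
  also have "\<dots> = \<iota> (\<Lambda> \<union> \<Lambda>') (local_tensor \<Lambda> \<Lambda>' a b)"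
    by (simp add: local_tensor_swap Un_commute)
  finally show ?thesis using embed_tensor assms by simp
qed

definition local_union :: "'a set" where
  "local_union = (\<Union>\<Lambda>\<in>{\<Lambda>. finite \<Lambda> \<and> \<Lambda> \<subseteq> lattice_edges}. \<iota> \<Lambda> ` local_algebra \<Lambda>)"

lemma local_unionI: "finite \<Lambda> \<Longrightarrow> \<Lambda> \<subseteq> lattice_edges \<Longrightarrow> a \<in> local_algebra \<Lambda> \<Longrightarrow> \<iota> \<Lambda> a \<in> local_union"
  by (auto simp: local_union_def)

lemma local_unionE2:
  assumes "x \<in> local_union" "y \<in> local_union"
  obtains \<Lambda> a b where "finite \<Lambda>" "\<Lambda> \<subseteq> lattice_edges" "a \<in> local_algebra \<Lambda>" "b \<in> local_algebra \<Lambda>"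
    "x = \<iota> \<Lambda> a" "y = \<iota> \<Lambda> b"
proof -
  obtain \<Lambda> a \<Lambda>' b where *: "finite \<Lambda>" "\<Lambda> \<subseteq> lattice_edges" "a \<in> local_algebra \<Lambda>" "x = \<iota> \<Lambda> a"
    "finite \<Lambda>'" "\<Lambda>' \<subseteq> lattice_edges" "b \<in> local_algebra \<Lambda>'" "y = \<iota> \<Lambda>' b"
    using assms by (auto simp: local_union_def)
  show ?thesis
    by (rule that[of "\<Lambda> \<union> \<Lambda>'" "local_incl \<Lambda> (\<Lambda> \<union> \<Lambda>') a" "local_incl \<Lambda>' (\<Lambda> \<union> \<Lambda>') b"])
      (use * in \<open>simp_all add: local_incl_in embed_incl\<close>)
qed

lemma local_union_closed:
  assumes "x \<in> local_union" "y \<in> local_union"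
  shows "x + y \<in> local_union" "x * y \<in> local_union" "c *\<^sub>C x \<in> local_union" "adj x \<in> local_union"
proof -
  obtain \<Lambda> a b where *: "finite \<Lambda>" "\<Lambda> \<subseteq> lattice_edges" "a \<in> local_algebra \<Lambda>" "b \<in> local_algebra \<Lambda>"
    "x = \<iota> \<Lambda> a" "y = \<iota> \<Lambda> b"
    using local_unionE2[OF assms] .
  note c = local_algebra_closed[OF *(3,4)]
  show "x + y \<in> local_union" "x * y \<in> local_union" "c *\<^sub>C x \<in> local_union" "adj x \<in> local_union"
    using local_unionI[OF *(1,2) c(1)] local_unionI[OF *(1,2) c(2), of c] local_unionI[OF *(1,2) c(3)]
      local_unionI[OF *(1,2) c(4)] *
    by (simp_all add: embed_add embed_mult embed_scale embed_adj)
qed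

lemma local_union_one: "1 \<in> local_union"
  using local_unionI[OF _ _ local_one_in, of "{}"] embed_one[of "{}"] by simp

text \<open>In a matrix algebra the sign of \<open>c\<close> is read off from a nonzero diagonal entry of \<open>p\<close>.\<close>

lemma local_union_pos:
  assumes "p \<in> local_union" "y \<in> local_union" and p: "projection p" "p \<noteq> 0" and y: "adj y * y = c *\<^sub>C p"
  shows "c \<in> \<real>\<^sub>\<ge>\<^sub>0"
proof -
  obtain \<Lambda> a b where *: "finite \<Lambda>" "\<Lambda> \<subseteq> lattice_edges" "a \<in> local_algebra \<Lambda>" "b \<in> local_algebra \<Lambda>"
    "y = \<iota> \<Lambda> a" "p = \<iota> \<Lambda> b"
    using local_unionE2[OF assms(2,1)] .
  have sq: "local_mult \<Lambda> (local_adj x) x s s = of_real (\<Sum>u\<in>configs \<Lambda>. (cmod (x u s))\<^sup>2)" for x s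
    by (simp add: local_mult_def local_adj_def complex_norm_square mult.commute del: of_real_power)
  note inj = inj_onD[OF embed_inj[OF *(1,2)]]
  note ca = local_algebra_closed[OF *(3,3)] and cb = local_algebra_closed[OF *(4,4)]
  have "\<iota> \<Lambda> (local_mult \<Lambda> (local_adj a) a) = \<iota> \<Lambda> (\<lambda>s t. c * b s t)"
    using y * ca by (simp add: embed_mult embed_adj embed_scale)
  then have a: "local_mult \<Lambda> (local_adj a) a = (\<lambda>s t. c * b s t)"
    by (rule inj) (use * ca cb local_algebra_closed(4) in auto)
  have "\<iota> \<Lambda> (local_mult \<Lambda> (local_adj b) b) = \<iota> \<Lambda> b"
    using p(1) * cb by (simp add: embed_mult embed_adj projection_def)
  then have b: "local_mult \<Lambda> (local_adj b) b = b"
    by (rule inj) (use * cb local_algebra_closed(4) in auto)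
  have "b \<noteq> (\<lambda>s t. 0)" using p(2) * embed_zero by auto
  \<comment> \<open>Since \<open>b\<close> is its adjoint times itself, a nonzero entry in column
    \<open>s\<close> makes the diagonal entry there positive.\<close>
  then obtain u s where us: "b u s \<noteq> 0" by (auto simp: fun_eq_iff)
  then have "u \<in> configs \<Lambda>" using *(4) by (auto simp: local_algebra_def)
  define q r where "q = (\<Sum>u\<in>configs \<Lambda>. (cmod (a u s))\<^sup>2)" and "r = (\<Sum>u\<in>configs \<Lambda>. (cmod (b u s))\<^sup>2)"
  have "0 < r" unfolding r_def
    by (rule sum_pos2[OF finite_configs[OF *(1)] \<open>u \<in> configs \<Lambda>\<close>]) (use us in auto)
  moreover have "0 \<le> q" unfolding q_def by (rule sum_nonneg) simp
  moreover have "of_real q = c * of_real r"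
    using sq[of a s] sq[of b s] unfolding a b q_def r_def by simp
  ultimately have "c = of_real (q / r)" "0 \<le> q / r" by (simp_all add: field_simps)
  then show ?thesis by (simp del: of_real_divide)
qed

end

section \<open>Pauli matrices at single edges\<close>

definition lattice_edge :: "edge_index \<Rightarrow> edge" where
  "lattice_edge = (\<lambda>(b, x, y). if b then {(x, y), (x + 1, y)} else {(x, y), (x, y + 1)})"

lemma lattice_edge_in: "lattice_edge i \<in> lattice_edges"
  by (cases i) (simp add: lattice_edge_def mem_lattice_edges)

lemma lattice_edge_eq_iff: "lattice_edge i = lattice_edge j \<longleftrightarrow> i = j"
  by (cases i; cases j) (auto simp: lattice_edge_def doubleton_eq_iff split: if_splits)

lemma lattice_edge_cases:
  assumes "e \<in> lattice_edges"
  obtains i where "e = lattice_edge i"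
proof -
  obtain u v where uv: "e = {u, v}" "\<bar>fst u - fst v\<bar> + \<bar>snd u - snd v\<bar> = 1"
    using assms by (auto simp: lattice_edges_def)
  obtain x y where u: "u = (x, y)" by (cases u)
  have "e \<in> {e \<in> lattice_edges. (x, y) \<in> e}" using assms uv u by simp
  then have "e = lattice_edge (True, x, y) \<or> e = lattice_edge (False, x, y) \<or>
      e = lattice_edge (True, x - 1, y) \<or> e = lattice_edge (False, x, y - 1)"
    unfolding edges_at_vertex by (auto simp: lattice_edge_def insert_commute)
  then show ?thesis using that by blast
qed

lemma vec_2_2_eq_iff: "(m :: complex^2^2) = n \<longleftrightarrow>
    m $ 1 $ 1 = n $ 1 $ 1 \<and> m $ 1 $ 2 = n $ 1 $ 2 \<and> m $ 2 $ 1 = n $ 2 $ 1 \<and> m $ 2 $ 2 = n $ 2 $ 2"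
  by (auto simp: vec_eq_iff forall_2)

context quasi_local_algebra
begin

definition site :: "edge \<Rightarrow> complex^2^2 \<Rightarrow> 'a" where
  "site e m = \<iota> {e} (site_matrix e m)"

context
  fixes e assumes e: "e \<in> lattice_edges"
begin

lemma singleton_region: "finite {e}" "{e} \<subseteq> lattice_edges"
  using e by auto

lemma site_mult: "site e m * site e n = site e (m ** n)"
  unfolding site_def site_matrix_mult[symmetric] by (rule embed_mult[OF singleton_region, symmetric]) (rule site_matrix_in)+

lemma site_one: "site e (mat 1) = 1"
  unfolding site_def site_matrix_one by (rule embed_one[OF singleton_region])

lemma site_adj: "adj (site e m) = site e (\<chi> i j. cnj (m $ j $ i))"
  unfolding site_def site_matrix_adj[symmetric] by (rule embed_adj[OF singleton_region, symmetric]) (rule site_matrix_in)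

lemma site_scale: "site e (\<chi> i j. c * m $ i $ j) = c *\<^sub>C site e m"
  unfolding site_def site_matrix_scale by (rule embed_scale[OF singleton_region]) (rule site_matrix_in)

lemma site_add: "site e (m + n) = site e m + site e n"
  unfolding site_def site_matrix_add by (rule embed_add[OF singleton_region]) (rule site_matrix_in)+

lemma site_minus: "site e (- m) = - site e m"
proof -
  have "- m = (\<chi> i j. (-1) * m $ i $ j)" by (simp add: vec_eq_iff)
  then show ?thesis using site_scale[of "-1" m] by (simp add: scaleC_minus_one)
qed

lemma symmetry_site:
  assumes "(\<chi> i j. cnj (m $ j $ i)) = m" "m ** m = mat 1"
  shows "symmetry (site e m)"
  using assms by (simp add: symmetry_def site_mult site_adj site_one)

text \<open>The identity, \<open>pauli_x\<close>, \<open>pauli_z\<close> and their product form a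
  basis of the 2 by 2 matrices; the real matrix \<open>pauli_x ** pauli_z\<close> takes the place of
  the third Pauli matrix, which is i times it.\<close>

lemma site_pauli_expansion:
  obtains \<alpha> \<beta> \<gamma> \<delta> where "site e m = \<alpha> *\<^sub>C 1 + \<beta> *\<^sub>C site e pauli_x + \<gamma> *\<^sub>C site e pauli_z +
    \<delta> *\<^sub>C (site e pauli_x * site e pauli_z)"
proof
  let ?s = "\<lambda>c n. \<chi> i j. c * (n :: complex^2^2) $ i $ j"
  have "m = ?s ((m $ 1 $ 1 + m $ 2 $ 2) / 2) (mat 1) + ?s ((m $ 1 $ 2 + m $ 2 $ 1) / 2) pauli_x +
      ?s ((m $ 1 $ 1 - m $ 2 $ 2) / 2) pauli_z +
      ?s ((m $ 2 $ 1 - m $ 1 $ 2) / 2) (pauli_x ** pauli_z)"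
    by (simp add: vec_2_2_eq_iff matrix_matrix_mult_def pauli_x_def pauli_z_def mat_def sum_2 field_simps)
  from arg_cong[OF this, of "site e"]
  show "site e m = ((m $ 1 $ 1 + m $ 2 $ 2) / 2) *\<^sub>C 1 + ((m $ 1 $ 2 + m $ 2 $ 1) / 2) *\<^sub>C site e pauli_x +
      ((m $ 1 $ 1 - m $ 2 $ 2) / 2) *\<^sub>C site e pauli_z +
      ((m $ 2 $ 1 - m $ 1 $ 2) / 2) *\<^sub>C (site e pauli_x * site e pauli_z)"
    by (simp only: site_add site_scale site_one site_mult)
qed

end

lemma site_commute:
  assumes "e \<in> lattice_edges" "e' \<in> lattice_edges" "e \<noteq> e'"
  shows "site e m * site e' n = site e' n * site e m"
  unfolding site_def by (rule embed_commute) (use assms site_matrix_in in auto)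

definition pauli_X :: "edge_index \<Rightarrow> 'a" where
  "pauli_X i = sigma_x \<iota> (lattice_edge i)"

definition pauli_Z :: "edge_index \<Rightarrow> 'a" where
  "pauli_Z i = sigma_z \<iota> (lattice_edge i)"

lemma pauli_site: "pauli_X i = site (lattice_edge i) pauli_x" "pauli_Z i = site (lattice_edge i) pauli_z"
  by (simp_all add: pauli_X_def pauli_Z_def sigma_x_def sigma_z_def site_def)

lemmas pauli_eval = vec_2_2_eq_iff matrix_matrix_mult_def pauli_x_def pauli_z_def mat_def sum_2

sublocale pauli_family pauli_X pauli_Z
proof
  note comm = site_commute[OF lattice_edge_in lattice_edge_in]
  show "symmetry (pauli_X i)" "symmetry (pauli_Z i)" for i
    unfolding pauli_site by (rule symmetry_site[OF lattice_edge_in]; simp add: pauli_eval)+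
  show "pauli_X i * pauli_X j = pauli_X j * pauli_X i" "pauli_Z i * pauli_Z j = pauli_Z j * pauli_Z i" for i j
    unfolding pauli_site by (cases "i = j"; simp add: comm lattice_edge_eq_iff)+
  show "pauli_X i * pauli_Z j = pauli_Z j * pauli_X i" if "i \<noteq> j" for i j
    unfolding pauli_site using that by (simp add: comm lattice_edge_eq_iff)
  show "pauli_X i * pauli_Z i = - (pauli_Z i * pauli_X i)" for i
  proof -
    have "pauli_x ** pauli_z = - (pauli_z ** pauli_x)" by (simp add: pauli_eval)
    then show ?thesis
      by (simp add: pauli_site site_mult[OF lattice_edge_in] site_minus[OF lattice_edge_in])
  qed
qed

lemma star_face_algebra_eq: "star_face_algebra \<iota> = star_face"
proof -
  \<comment> \<open>The star lists its left and lower edges from the central vertex,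
    \<open>lattice_edge\<close> from the left or lower end; \<open>insert_commute\<close> reconciles
    them.\<close>
  have "star_operator \<iota> x y = X_prod (star_set x y)" for x y
    by (simp add: star_operator_def star_set_def X.commuting_prod_insert X.commuting_prod_empty
        pauli_X_def lattice_edge_def mult.assoc insert_commute[of "(x - 1, y)"] insert_commute[of "(x, y - 1)"])
  moreover have "face_operator \<iota> x y = Z_prod (face_set x y)" for x y
    by (simp add: face_operator_def face_set_def Z.commuting_prod_insert Z.commuting_prod_empty
        pauli_Z_def lattice_edge_def mult.assoc)
  ultimately show ?thesis
    by (simp add: star_face_algebra_def stars_and_faces_def)
qed

lemma pauli_prod_local: "finite S \<Longrightarrow> X_prod S \<in> local_union" "finite S \<Longrightarrow> Z_prod S \<in> local_union"
proof -
  have "site (lattice_edge i) m \<in> local_union" for i m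
    unfolding site_def using lattice_edge_in by (intro local_unionI site_matrix_in) auto
  then show "finite S \<Longrightarrow> X_prod S \<in> local_union" "finite S \<Longrightarrow> Z_prod S \<in> local_union"
    by (simp_all add: X.commuting_prod_closed Z.commuting_prod_closed local_union_one local_union_closed(2)
        pauli_site)
qed

lemma site_mult_span:
  assumes "e \<in> lattice_edges" "x \<in> complex_span pauli_monomials"
  shows "site e m * x \<in> complex_span pauli_monomials"
proof -
  obtain i where i: "e = lattice_edge i" using lattice_edge_cases[OF assms(1)] .
  obtain \<alpha> \<beta> \<gamma> \<delta> where "site e m = \<alpha> *\<^sub>C 1 + \<beta> *\<^sub>C site e pauli_x + \<gamma> *\<^sub>C site e pauli_z +
    \<delta> *\<^sub>C (site e pauli_x * site e pauli_z)"
    using site_pauli_expansion[OF assms(1)] .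
  then have "site e m * x = \<alpha> *\<^sub>C x + \<beta> *\<^sub>C (pauli_X i * x) + \<gamma> *\<^sub>C (pauli_Z i * x) +
    \<delta> *\<^sub>C (pauli_X i * (pauli_Z i * x))"
    by (simp add: i pauli_site distrib_right mult_scaleC_left mult.assoc)
  also have "\<dots> \<in> complex_span pauli_monomials"
    by (intro complex_span.add complex_span.scale X_mult_span Z_mult_span assms)
  finally show ?thesis .
qed

lemma sum_in_complex_span:
  "finite K \<Longrightarrow> (\<And>k. k \<in> K \<Longrightarrow> x k \<in> complex_span pauli_monomials) \<Longrightarrow>
    (\<Sum>k\<in>K. x k) \<in> complex_span pauli_monomials"
proof (induction rule: finite_induct)
  case empty
  then show ?case using complex_span.scale[OF one_in_span, of 0] by (simp add: scaleC_zero_left)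
qed (simp add: complex_span.add)

text \<open>Splitting off one edge writes a matrix as a sum of matrix units at that edge tensored
  with blocks on the rest, and left multiplication by a one-edge operator preserves the
  span.\<close>

lemma embed_in_span:
  assumes "finite \<Lambda>" "\<Lambda> \<subseteq> lattice_edges" "a \<in> local_algebra \<Lambda>"
  shows "\<iota> \<Lambda> a \<in> complex_span pauli_monomials"
  using assms
proof (induction arbitrary: a rule: finite_induct)
  case empty
  have c: "configs {} = {\<lambda>_. undefined}" by (simp add: configs_def)
  have "a = (\<lambda>s t. a (\<lambda>_. undefined) (\<lambda>_. undefined) * local_one {} s t)"
  proof (intro ext)
    show "a s t = a (\<lambda>_. undefined) (\<lambda>_. undefined) * local_one {} s t" for s t
      using empty.prems(2) by (cases "s = (\<lambda>_. undefined) \<and> t = (\<lambda>_. undefined)")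
        (auto simp: local_algebra_def local_one_def c)
  qed
  then have "\<iota> {} a = a (\<lambda>_. undefined) (\<lambda>_. undefined) *\<^sub>C 1"
    using embed_scale[of "{}" "local_one {}"] local_one_in embed_one[of "{}"]
    by (metis empty.prems(1) finite.emptyI)
  then show ?case by (simp add: complex_span.scale one_in_span)
next
  case (insert e \<Lambda>)
  define \<Lambda>' where "\<Lambda>' = {e} \<union> \<Lambda>"
  have e: "e \<in> lattice_edges" and \<Lambda>: "finite \<Lambda>" "\<Lambda> \<subseteq> lattice_edges" and \<Lambda>': "finite \<Lambda>'" "\<Lambda>' \<subseteq> lattice_edges"
    and a: "a \<in> local_algebra \<Lambda>'"
    using insert by (auto simp: \<Lambda>'_def)
  define unit :: "2 \<times> 2 \<Rightarrow> complex^2^2" where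
    "unit k = (\<chi> i j. if (i, j) = k then 1 else 0)" for k
  define block :: "2 \<times> 2 \<Rightarrow> local_matrix" where
    "block k = (\<lambda>s t. if s \<in> configs \<Lambda> \<and> t \<in> configs \<Lambda> then a (s(e := fst k)) (t(e := snd k)) else 0)" for k
  have block: "block k \<in> local_algebra \<Lambda>" for k by (simp add: block_def local_algebra_def)
  have "a s t = (\<Sum>k\<in>UNIV. local_tensor {e} \<Lambda> (site_matrix e (unit k)) (block k) s t)" for s t
  proof (cases "s \<in> configs \<Lambda>' \<and> t \<in> configs \<Lambda>'")
    case True
    \<comment> \<open>A configuration on \<Lambda>' is \<open>undefined\<close> off its region, so
      restricting it to \<Lambda> and restoring the value at \<open>e\<close> loses nothing.\<close>
    have r: "(restrict u \<Lambda>)(e := u e) = u" if "u \<in> configs \<Lambda>'" for u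
      using that insert.hyps by (auto simp: fun_eq_iff configs_def \<Lambda>'_def PiE_def extensional_def)
    have "local_tensor {e} \<Lambda> (site_matrix e (unit k)) (block k) s t = (if k = (s e, t e) then a s t else 0)" for k
      using True r[of s] r[of t] restrict_configs[of _ \<Lambda>] restrict_configs[of _ "{e}"]
      by (auto simp: local_tensor_def site_matrix_def unit_def block_def \<Lambda>'_def)
    then show ?thesis by simp
  next
    case False
    then have "a s t = 0" using a by (auto simp: local_algebra_def)
    then show ?thesis using False by (auto simp: local_tensor_def \<Lambda>'_def)
  qed
  then have "\<iota> \<Lambda>' a = \<iota> \<Lambda>' (\<lambda>s t. \<Sum>k\<in>UNIV. local_tensor {e} \<Lambda> (site_matrix e (unit k)) (block k) s t)"
    by (intro arg_cong[of _ _ "\<iota> \<Lambda>'"] ext)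
  also have "\<dots> = (\<Sum>k\<in>UNIV. \<iota> \<Lambda>' (local_tensor {e} \<Lambda> (site_matrix e (unit k)) (block k)))"
    using local_tensor_in[of "{e}" \<Lambda>] by (intro embed_sum \<Lambda>') (simp_all add: \<Lambda>'_def)
  also have "\<dots> = (\<Sum>k\<in>UNIV. site e (unit k) * \<iota> \<Lambda> (block k))"
    unfolding \<Lambda>'_def site_def
    by (intro sum.cong refl embed_tensor \<Lambda> site_matrix_in block) (use e insert.hyps in auto)
  also have "\<dots> \<in> complex_span pauli_monomials"
    by (intro sum_in_complex_span site_mult_span[OF e] insert.IH \<Lambda> block) simp
  finally show ?case by (simp add: \<Lambda>'_def)
qed

sublocale unique_extension star_face local_union pauli_monomials
proof
  have local: "u \<in> local_union" if "u \<in> stars_and_faces" for u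
    using that by (auto simp: stars_and_faces_def pauli_prod_local)
  show "g \<in> star_face \<inter> local_union \<and> symmetry g \<or>
      (\<exists>u\<in>star_face \<inter> local_union. symmetry u \<and> u * g = - (g * u))"
    if "g \<in> pauli_monomials" for g
  proof -
    have "g \<in> local_union"
      using that by (auto simp: pauli_monomials_def pauli_prod_local local_union_closed(2))
    then show ?thesis
      using pauli_dichotomy[OF that] local symmetry_stars_and_faces generated_superset[of stars_and_faces]
      by blast
  qed
  show "local_union \<subseteq> complex_span pauli_monomials"
    by (auto simp: local_union_def embed_in_span)
  show "closure local_union = UNIV" using embed_dense by (simp add: local_union_def)
  show "x + y \<in> local_union" "x * y \<in> local_union" if "x \<in> local_union" "y \<in> local_union" for x y
    using local_union_closed[OF that] by blast+
  show "c *\<^sub>C x \<in> local_union" "adj x \<in> local_union" if "x \<in> local_union" for c x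
    using local_union_closed[OF that that] by blast+
qed (fact sub_cstar_algebra_generated one_in_star_face star_face_commutative local_union_one
    local_union_pos)+

end

theorem corollary3p7:
  fixes \<iota> :: "edge set \<Rightarrow> local_matrix \<Rightarrow> 'a::cstar_algebra"
  assumes "quasi_local_algebra \<iota>"
  shows "\<forall>\<omega>. pure_state_on (star_face_algebra \<iota>) \<omega> \<longrightarrow>
    (\<exists>!\<phi>. pure_state_on UNIV \<phi> \<and> (\<forall>x\<in>star_face_algebra \<iota>. \<phi> x = \<omega> x))"
proof (intro allI impI)
  interpret quasi_local_algebra \<iota> by fact
  fix \<omega> assume "pure_state_on (star_face_algebra \<iota>) \<omega>"
  then interpret extended_pure_state star_face local_union pauli_monomials \<omega>
    by unfold_locales (simp add: star_face_algebra_eq)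
  show "\<exists>!\<phi>. pure_state_on UNIV \<phi> \<and> (\<forall>x\<in>star_face_algebra \<iota>. \<phi> x = \<omega> x)"
    unfolding star_face_algebra_eq by (rule unique_pure_extension)
qed

end
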